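(* Let $d\ge 1$ and $p\in[0,1]$ with $p_d=\frac{2d+1}{4d}<p\le 1$, let $(S_n)$ be the $d$-dimensional elephant random walk with memory parameter $p$ described in the context, and let $a=\frac{2dp-1}{2d-1}$. Then there is a non-degenerate random vector $L$ in $\mathbb{R}^d$ such that $$\lim_{n\to\infty}\frac{1}{n^a}S_n=L\quad\text{a.s.},$$ and moreover $$\lim_{n\to\infty}\mathbb{E}\Bigl[\Bigl\|\frac{1}{n^a}S_n-L\Bigr\|^2\Bigr]=0.$$
   Context: Multi-dimensional elephant random walk (MERW). Fix a dimension $d\ge1$ and a memory parameter $p\in[0,1]$. Let $(e_1,\dots,e_d)$ be the standard basis of $\mathbb{R}^d$, $I_d$ the $d\times d$ identity matrix, and $J_d$ the $d\times d$ cyclic permutation matrix with entries $(J_d)_{i,i+1}=1$ for $1\le i\le d-1$, $(J_d)_{d,1}=1$, and all other entries $0$. Set $S_0=0$. The first step $X_1$ is uniformly distributed on $\{\pm e_1,\dots,\pm e_d\}$. For $n\ge1$, given $\mathcal{F}_n=\sigma(X_1,\dots,X_n)$, $X_{n+1}=A_nX_{b_n}$, where $b_n$ is uniform on $\{1,\dots,n\}$ and $A_n$ is a random matrix, with $b_n$, $A_n$ independent of each other and of $\mathcal{F}_n$, equal to $I_d$ with probability $p$ and to each of $-I_d,\ \pm J_d,\dots,\pm J_d^{d-1}$ with probability $\frac{1-p}{2d-1}$. The position is $S_n=X_1+\dots+X_n$; $\|\cdot\|$ is the Euclidean norm. *)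

theory Defs
  imports "HOL-Probability.Probability"
begin

text \<open>Coordinates are indexed by a finite linearly ordered type 'd, identified with
  {1,...,d} (d = CARD('d)) in increasing order. cyc_succ i is the next index, the
  largest index being sent to the smallest one.\<close>

definition cyc_succ :: "'d::{finite,linorder} \<Rightarrow> 'd" where
  "cyc_succ i = (if \<exists>j. i < j then (LEAST j. i < j) else (LEAST j. True))"

definition cycJ :: "real^('d::{finite,linorder})^('d::{finite,linorder})" where
  "cycJ = (\<chi> i j. if j = cyc_succ i then 1 else 0)"

definition cycJ_pow :: "nat \<Rightarrow> real^('d::{finite,linorder})^('d::{finite,linorder})" where
  "cycJ_pow k = ((\<lambda>A. A ** cycJ) ^^ k) (mat 1)"

definition signed_basis :: "(real^'d::finite) set" where
  "signed_basis = {axis i 1 | i. True} \<union> {axis i (-1) | i. True}"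

definition other_mats :: "(real^('d::{finite,linorder})^('d::{finite,linorder})) set" where
  "other_mats = {- mat 1} \<union> {cycJ_pow k | k. 1 \<le> k \<and> k \<le> CARD('d) - 1}
      \<union> {- cycJ_pow k | k. 1 \<le> k \<and> k \<le> CARD('d) - 1}"

end

theory Submission
  imports Defs
begin

text \<open>The mean of \<open>A n\<close> is \<open>a\<close> times the identity, because the matrices \<open>\<plusminus>J\<^sup>k\<close> with \<open>k \<ge> 1\<close>
  cancel in pairs; hence the conditional expectation of \<open>X (n+1)\<close> given the first \<open>n\<close> steps is
  \<open>(a / n) S n\<close>. With the weights \<open>w n = \<Gamma>(a + 1) \<Gamma>(n) / \<Gamma>(n + a)\<close> the process
  \<open>w n S n\<close> is therefore a martingale. Its increments are bounded by \<open>2 w n\<close>, which is of order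
  \<open>n powr (- a)\<close> and square summable since \<open>a > 1/2\<close>. Kolmogorov's inequality gives almost sure
  convergence, orthogonality of increments gives convergence in mean square, and
  \<open>w n * n powr a\<close> tends to \<open>a \<Gamma>(a)\<close>.\<close>

section \<open>Martingales with square summable increment bounds\<close>

text \<open>The threshold on \<open>p\<close> is a condition of square summability: p > (2d+1)/(4d)
  is the same as a > 1/2, and this makes the squares of numbers of order n^(-a) summable. The
  weights solve w(n+1)(1 + a/n) = w(n), which cancels the growth of the conditional mean of the
  position. No conditional expectation operator appears. The martingale property is used only after
  integration against bounded vectors measurable with respect to the past. This weak form serves
  with three kinds of test vector: a partial sum, a stopped partial sum, and a function of the first
  step. The last one is for non-degeneracy, which convergence alone does not give: the limit still
  remembers the first step.\<close>

text \<open>\<open>D n\<close> is revealed at time \<open>Suc n\<close>, so \<open>F n\<close> is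
  the information available just before it. Vanishing against every bounded
  \<open>F n\<close>-measurable vector says that \<open>D n\<close> has conditional mean zero.
  Bounds are almost sure because the laws of the walk's inputs fix their values only up to null
  sets.\<close>

locale bounded_martingale_differences = prob_space M
  for M :: "'a measure" +
  fixes F :: "nat \<Rightarrow> 'a measure"
    and D :: "nat \<Rightarrow> 'a \<Rightarrow> 'b::euclidean_space"
    and c :: "nat \<Rightarrow> real"
  assumes subalg: "\<And>n. subalgebra M (F n)"
    and filtration: "\<And>n. sets (F n) \<subseteq> sets (F (Suc n))"
    and adapted: "\<And>n. D n \<in> borel_measurable (F (Suc n))"
    and increment_bound: "\<And>n. AE \<omega> in M. norm (D n \<omega>) \<le> c n"
    and increment_orthogonal: "\<And>n h C. h \<in> borel_measurable (F n) \<Longrightarrow> (AE \<omega> in M. norm (h \<omega>) \<le> C)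
        \<Longrightarrow> (\<integral>\<omega>. h \<omega> \<bullet> D n \<omega> \<partial>M) = 0"
    and summable_squares: "summable (\<lambda>n. (c n)\<^sup>2)"
begin

lemma space_F: "space (F n) = space M"
  using subalg by (simp add: subalgebra_def)

lemma filtration_mono: "m \<le> n \<Longrightarrow> sets (F m) \<subseteq> sets (F n)"
  using filtration by (rule lift_Suc_mono_le)

lemma measurable_F_mono:
  "f \<in> borel_measurable (F m) \<Longrightarrow> m \<le> n \<Longrightarrow> f \<in> borel_measurable (F n)"
  using filtration_mono[of m n] by (auto simp: measurable_def space_F)

lemma measurable_F: "f \<in> borel_measurable (F n) \<Longrightarrow> f \<in> borel_measurable M"
  using measurable_from_subalg[OF subalg] .

lemma D_measurable [measurable]: "D n \<in> borel_measurable M"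
  using adapted measurable_F by blast

lemma c_nonneg: "0 \<le> c n"
proof -
  have "AE \<omega> in M. 0 \<le> c n"
    using increment_bound[of n] by eventually_elim (use norm_ge_zero order_trans in blast)
  then show ?thesis by simp
qed

lemma partial_sum_adapted: "n \<le> N \<Longrightarrow> (\<lambda>\<omega>. \<Sum>j\<in>{m..<n}. D j \<omega>) \<in> borel_measurable (F N)"
  by (intro borel_measurable_sum measurable_F_mono[OF adapted]) auto

section \<open>Second moments of martingale transforms\<close>

text \<open>The factor \<open>T j\<close> is known before \<open>D j\<close> is revealed, so it can
  be absorbed into the test vector; the cross terms vanish and second moments add up.
  \<open>T\<close> constantly 1 gives the plain sums, an exit indicator gives the stopped
  ones.\<close>

lemma transform_square_integral:
  assumes T: "\<And>j. T j \<in> borel_measurable (F j)"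
    and T01: "\<And>j \<omega>. 0 \<le> T j \<omega> \<and> T j \<omega> \<le> (1::real)"
  shows "integrable M (\<lambda>\<omega>. (norm (\<Sum>j\<in>{m..<n}. T j \<omega> *\<^sub>R D j \<omega>))\<^sup>2)"
    and "(\<integral>\<omega>. (norm (\<Sum>j\<in>{m..<n}. T j \<omega> *\<^sub>R D j \<omega>))\<^sup>2 \<partial>M) \<le> (\<Sum>j\<in>{m..<n}. (c j)\<^sup>2)"
proof -
  define Z where "Z n \<omega> = (\<Sum>j\<in>{m..<n}. T j \<omega> *\<^sub>R D j \<omega>)" for n \<omega>
  have T_mono: "j \<le> k \<Longrightarrow> T j \<in> borel_measurable (F k)" for j k
    using T measurable_F_mono by blast
  have D_mono: "j < k \<Longrightarrow> D j \<in> borel_measurable (F k)" for j k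
    using adapted measurable_F_mono[of "D j" "Suc j" k] by auto
  have ZF: "Z n \<in> borel_measurable (F n)" for n
    unfolding Z_def by (intro borel_measurable_sum borel_measurable_scaleR T_mono D_mono) auto
  have [measurable]: "Z n \<in> borel_measurable M" "T n \<in> borel_measurable M" for n
    using ZF T measurable_F by blast+
  have TD: "AE \<omega> in M. norm (T j \<omega> *\<^sub>R D j \<omega>) \<le> c j" for j
    using increment_bound[of j]
  proof eventually_elim
    case (elim \<omega>)
    have "norm (T j \<omega> *\<^sub>R D j \<omega>) \<le> 1 * norm (D j \<omega>)"
      unfolding norm_scaleR using T01[of j \<omega>] by (intro mult_right_mono) auto
    then show ?case using elim by simp
  qed
  have Zb: "AE \<omega> in M. norm (Z n \<omega>) \<le> (\<Sum>j\<in>{m..<n}. c j)" for n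
  proof -
    have "AE \<omega> in M. \<forall>j\<in>{m..<n}. norm (T j \<omega> *\<^sub>R D j \<omega>) \<le> c j"
      using TD by (intro AE_finite_allI) auto
    then show ?thesis unfolding Z_def by eventually_elim (intro sum_norm_le, auto)
  qed
  have Zint: "integrable M (\<lambda>\<omega>. (norm (Z n \<omega>))\<^sup>2)" for n
    by (rule integrable_const_bound[where B="(\<Sum>j\<in>{m..<n}. c j)\<^sup>2"])
      (use Zb[of n] in \<open>auto elim!: eventually_mono intro!: power_mono\<close>)
  have TDint: "integrable M (\<lambda>\<omega>. (norm (T n \<omega> *\<^sub>R D n \<omega>))\<^sup>2)" for n
    by (rule integrable_const_bound[where B="(c n)\<^sup>2"])
      (use TD[of n] in eventually_elim, simp del: norm_scaleR add: power_mono, measurable)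
  have TDle: "(\<integral>\<omega>. (norm (T n \<omega> *\<^sub>R D n \<omega>))\<^sup>2 \<partial>M) \<le> (c n)\<^sup>2" for n
  proof -
    have "(\<integral>\<omega>. (norm (T n \<omega> *\<^sub>R D n \<omega>))\<^sup>2 \<partial>M) \<le> (\<integral>\<omega>. (c n)\<^sup>2 \<partial>M)"
      by (rule integral_mono_AE[OF TDint])
        (simp, use TD[of n] in eventually_elim, simp del: norm_scaleR add: power_mono)
    then show ?thesis by (simp add: prob_space)
  qed
  have ZTb: "AE \<omega> in M. norm (T n \<omega> *\<^sub>R Z n \<omega>) \<le> (\<Sum>j\<in>{m..<n}. c j)" for n
    using Zb[of n]
  proof eventually_elim
    case (elim \<omega>)
    have "norm (T n \<omega> *\<^sub>R Z n \<omega>) \<le> 1 * norm (Z n \<omega>)"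
      unfolding norm_scaleR using T01[of n \<omega>] by (intro mult_right_mono) auto
    then show ?case using elim by simp
  qed
  \<comment> \<open>Both factors are \<open>F n\<close>-measurable and their product is almost
    surely bounded, so it is an admissible test vector for \<open>D n\<close>.\<close>
  have orth: "(\<integral>\<omega>. (T n \<omega> *\<^sub>R Z n \<omega>) \<bullet> D n \<omega> \<partial>M) = 0" for n
    by (rule increment_orthogonal[OF _ ZTb]) (intro borel_measurable_scaleR T ZF)
  have ZDint: "integrable M (\<lambda>\<omega>. (T n \<omega> *\<^sub>R Z n \<omega>) \<bullet> D n \<omega>)" for n
  proof (rule integrable_const_bound[where B="(\<Sum>j\<in>{m..<n}. c j) * c n"])
    show "AE \<omega> in M. norm ((T n \<omega> *\<^sub>R Z n \<omega>) \<bullet> D n \<omega>) \<le> (\<Sum>j\<in>{m..<n}. c j) * c n"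
      using ZTb[of n] increment_bound[of n]
    proof eventually_elim
      case (elim \<omega>)
      have "norm ((T n \<omega> *\<^sub>R Z n \<omega>) \<bullet> D n \<omega>) \<le> norm (T n \<omega> *\<^sub>R Z n \<omega>) * norm (D n \<omega>)"
        by (simp only: real_norm_def Cauchy_Schwarz_ineq2)
      also have "\<dots> \<le> (\<Sum>j\<in>{m..<n}. c j) * c n"
        using elim by (intro mult_mono) (auto intro: sum_nonneg c_nonneg)
      finally show ?case .
    qed
  qed measurable
  have "(\<integral>\<omega>. (norm (Z n \<omega>))\<^sup>2 \<partial>M) \<le> (\<Sum>j\<in>{m..<n}. (c j)\<^sup>2)" for n
  proof (induction n)
    case 0
    then show ?case by (simp add: Z_def)
  next
    case (Suc n)
    show ?case
    proof (cases "m \<le> n")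
      case True
      have "(norm (Z (Suc n) \<omega>))\<^sup>2 = (norm (Z n \<omega>))\<^sup>2 + 2 * ((T n \<omega> *\<^sub>R Z n \<omega>) \<bullet> D n \<omega>)
          + (norm (T n \<omega> *\<^sub>R D n \<omega>))\<^sup>2" for \<omega>
      proof -
        have "Z (Suc n) \<omega> = Z n \<omega> + T n \<omega> *\<^sub>R D n \<omega>" using True by (simp add: Z_def)
        then show ?thesis
          by (simp only: power2_norm_eq_inner) (simp add: algebra_simps inner_commute)
      qed
      then have "(\<integral>\<omega>. (norm (Z (Suc n) \<omega>))\<^sup>2 \<partial>M) = (\<integral>\<omega>. (norm (Z n \<omega>))\<^sup>2 \<partial>M)
          + 2 * (\<integral>\<omega>. (T n \<omega> *\<^sub>R Z n \<omega>) \<bullet> D n \<omega> \<partial>M) + (\<integral>\<omega>. (norm (T n \<omega> *\<^sub>R D n \<omega>))\<^sup>2 \<partial>M)"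
        using Zint[of n] ZDint[of n] TDint[of n] by (simp del: norm_scaleR inner_scaleR_left)
      then show ?thesis using orth[of n] TDle[of n] Suc True by simp
    qed (simp add: Z_def)
  qed
  then show "(\<integral>\<omega>. (norm (\<Sum>j\<in>{m..<n}. T j \<omega> *\<^sub>R D j \<omega>))\<^sup>2 \<partial>M) \<le> (\<Sum>j\<in>{m..<n}. (c j)\<^sup>2)"
    and "integrable M (\<lambda>\<omega>. (norm (\<Sum>j\<in>{m..<n}. T j \<omega> *\<^sub>R D j \<omega>))\<^sup>2)"
    using Zint[of n] by (simp_all add: Z_def)
qed

lemma partial_sum_square_integral:
  shows "integrable M (\<lambda>\<omega>. (norm (\<Sum>j\<in>{m..<n}. D j \<omega>))\<^sup>2)"
    and "(\<integral>\<omega>. (norm (\<Sum>j\<in>{m..<n}. D j \<omega>))\<^sup>2 \<partial>M) \<le> (\<Sum>j\<in>{m..<n}. (c j)\<^sup>2)"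
  using transform_square_integral[of "\<lambda>_ _. 1" m n] by simp_all

text \<open>The bound is free of \<open>n\<close>, which lets estimates on finite blocks pass to
  infinite ones.\<close>

lemma sum_squares_le_tail: "(\<Sum>j\<in>{m..<n}. (c j)\<^sup>2) \<le> (\<Sum>j. (c (j + m))\<^sup>2)"
proof -
  have "(\<Sum>j\<in>{m..<n}. (c j)\<^sup>2) = (\<Sum>j<n-m. (c (j + m))\<^sup>2)"
    by (rule sum.reindex_bij_witness[of _ "\<lambda>j. j + m" "\<lambda>j. j - m"]) auto
  also have "\<dots> \<le> (\<Sum>j. (c (j + m))\<^sup>2)"
    by (intro sum_le_suminf summable_ignore_initial_segment summable_squares) auto
  finally show ?thesis .
qed

text \<open>Kolmogorov's inequality: stopping the sum at its first exit from the ball of radius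
  \<open>e\<close> is a martingale transform, and the stopped sum keeps norm at least \<open>e\<close>.\<close>

lemma maximal_inequality:
  assumes e: "0 < e"
  shows "prob {\<omega>\<in>space M. \<exists>k\<in>{m..n}. e \<le> norm (\<Sum>j\<in>{m..<k}. D j \<omega>)}
    \<le> (\<Sum>j. (c (j + m))\<^sup>2) / e\<^sup>2"
proof -
  \<comment> \<open>\<open>T i\<close> looks only at increments with index below \<open>i\<close>,
    so it is \<open>F i\<close>-measurable. If the sum first leaves the ball at \<open>k\<close>,
    then \<open>T k\<close> is 0 but the increment \<open>D (k - 1)\<close> that causes the exit
    still has factor 1.\<close>
  define T :: "nat \<Rightarrow> 'a \<Rightarrow> real"
    where "T i \<omega> = (if \<forall>k\<in>{m..i}. norm (\<Sum>j\<in>{m..<k}. D j \<omega>) < e then 1 else 0)" for i \<omega>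
  have TF: "T i \<in> borel_measurable (F i)" for i
  proof -
    have [measurable]: "(\<lambda>\<omega>. \<Sum>j\<in>{m..<k}. D j \<omega>) \<in> borel_measurable (F i)" if "k \<in> {m..i}" for k
      using that by (intro partial_sum_adapted) auto
    show ?thesis unfolding T_def by measurable
  qed
  have T01: "0 \<le> T i \<omega> \<and> T i \<omega> \<le> 1" for i \<omega> by (simp add: T_def)
  note Tint = transform_square_integral[OF TF T01, where m=m and n=n]
  have "prob {\<omega>\<in>space M. \<exists>k\<in>{m..n}. e \<le> norm (\<Sum>j\<in>{m..<k}. D j \<omega>)}
      \<le> prob {\<omega>\<in>space M. e\<^sup>2 \<le> (norm (\<Sum>j\<in>{m..<n}. T j \<omega> *\<^sub>R D j \<omega>))\<^sup>2}"
  proof (rule finite_measure_mono)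
    show "{\<omega> \<in> space M. e\<^sup>2 \<le> (norm (\<Sum>j = m..<n. T j \<omega> *\<^sub>R D j \<omega>))\<^sup>2} \<in> events"
      using borel_measurable_integrable[OF Tint(1)] by measurable
    show "{\<omega>\<in>space M. \<exists>k\<in>{m..n}. e \<le> norm (\<Sum>j\<in>{m..<k}. D j \<omega>)}
      \<subseteq> {\<omega>\<in>space M. e\<^sup>2 \<le> (norm (\<Sum>j\<in>{m..<n}. T j \<omega> *\<^sub>R D j \<omega>))\<^sup>2}"
    proof clarify
      fix \<omega> k0 assume "\<omega> \<in> space M" and k0: "k0 \<in> {m..n}" "e \<le> norm (\<Sum>j\<in>{m..<k0}. D j \<omega>)"
      define P where "P k \<longleftrightarrow> k \<in> {m..n} \<and> e \<le> norm (\<Sum>j\<in>{m..<k}. D j \<omega>)" for k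
      define k where "k = (LEAST k. P k)"
      have "P k0" using k0 by (simp add: P_def)
      then have Pk: "P k" unfolding k_def by (rule LeastI)
      have least: "k \<le> i" if "P i" for i unfolding k_def using that by (rule Least_le)
      have T: "T i \<omega> = (if i < k then 1 else 0)" if "i \<in> {m..<n}" for i
      proof (cases "i < k")
        case True
        have "norm (\<Sum>j\<in>{m..<l}. D j \<omega>) < e" if l: "l \<in> {m..i}" for l
        proof (rule ccontr)
          assume "\<not> ?thesis"
          then have "P l" using l \<open>i \<in> {m..<n}\<close> by (auto simp: P_def)
          then show False using least l True by fastforce
        qed
        then show ?thesis using True by (simp add: T_def)
      next
        case False
        then show ?thesis using Pk that by (force simp: P_def T_def)
      qed
      have "(\<Sum>j\<in>{m..<n}. T j \<omega> *\<^sub>R D j \<omega>) = (\<Sum>j\<in>{m..<k}. D j \<omega>)"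
        using Pk T by (intro sum.mono_neutral_cong_right) (auto simp: P_def)
      then show "e\<^sup>2 \<le> (norm (\<Sum>j\<in>{m..<n}. T j \<omega> *\<^sub>R D j \<omega>))\<^sup>2"
        using Pk e by (auto simp: P_def intro!: power_mono)
    qed
  qed
  also have "\<dots> \<le> (\<integral>\<omega>. (norm (\<Sum>j\<in>{m..<n}. T j \<omega> *\<^sub>R D j \<omega>))\<^sup>2 \<partial>M) / e\<^sup>2"
    using e by (intro integral_Markov_inequality_measure[OF Tint(1), where A="{}"]) auto
  also have "\<dots> \<le> (\<Sum>j. (c (j + m))\<^sup>2) / e\<^sup>2"
    using Tint(2) sum_squares_le_tail[of m n] by (intro divide_right_mono) auto
  finally show ?thesis .
qed

section \<open>Almost sure convergence of the series of increments\<close>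

lemma tail_squares_tendsto_0: "(\<lambda>m. \<Sum>j. (c (j + m))\<^sup>2) \<longlonglongrightarrow> 0"
  using suminf_exist_split2[OF summable_squares] .

text \<open>The events with finite horizon increase to this one, and their common bound does not
  depend on the horizon.\<close>

lemma maximal_inequality_tail:
  assumes e: "0 < e"
  shows "prob {\<omega>\<in>space M. \<exists>k\<ge>m. e \<le> norm (\<Sum>j\<in>{m..<k}. D j \<omega>)}
    \<le> (\<Sum>j. (c (j + m))\<^sup>2) / e\<^sup>2"
proof -
  define B where "B n = {\<omega>\<in>space M. \<exists>k\<in>{m..n}. e \<le> norm (\<Sum>j\<in>{m..<k}. D j \<omega>)}" for n
  have "range B \<subseteq> events" unfolding B_def by auto
  moreover have "incseq B"
    by (rule incseq_SucI) (auto simp: B_def)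
  ultimately have "(\<lambda>n. prob (B n)) \<longlonglongrightarrow> prob (\<Union>n. B n)"
    by (rule finite_Lim_measure_incseq)
  moreover have "(\<Union>n. B n) = {\<omega>\<in>space M. \<exists>k\<ge>m. e \<le> norm (\<Sum>j\<in>{m..<k}. D j \<omega>)}"
    unfolding B_def by force
  ultimately show ?thesis
    using maximal_inequality[OF e, of m] by (intro Lim_bounded[of "\<lambda>n. prob (B n)" _ 0]) (auto simp: B_def)
qed

text \<open>The exceptional event lies inside the exceedance event for every starting index
  \<open>m\<close>, and the bounds on these are tails of a convergent series, so its probability is
  0.\<close>

lemma AE_small_oscillation:
  assumes e: "0 < e"
  shows "AE \<omega> in M. \<exists>m. \<forall>k\<ge>m. norm (\<Sum>j\<in>{m..<k}. D j \<omega>) < e"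
proof -
  define N where "N = {\<omega>\<in>space M. \<forall>m. \<exists>k\<ge>m. e \<le> norm (\<Sum>j\<in>{m..<k}. D j \<omega>)}"
  have N: "N \<in> events" unfolding N_def by measurable
  have "prob N \<le> (\<Sum>j. (c (j + m))\<^sup>2) / e\<^sup>2" for m
  proof -
    have "prob N \<le> prob {\<omega>\<in>space M. \<exists>k\<ge>m. e \<le> norm (\<Sum>j\<in>{m..<k}. D j \<omega>)}"
      by (rule finite_measure_mono) (auto simp: N_def)
    then show ?thesis using maximal_inequality_tail[OF e, of m] by linarith
  qed
  moreover have "(\<lambda>m. (\<Sum>j. (c (j + m))\<^sup>2) / e\<^sup>2) \<longlonglongrightarrow> 0"
    using tendsto_divide[OF tail_squares_tendsto_0 tendsto_const, of "e\<^sup>2"] e by simp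
  ultimately have "prob N \<le> 0"
    by (intro LIMSEQ_le_const) auto
  then have "N \<in> null_sets M"
    using N by (auto simp: null_sets_def emeasure_eq_measure measure_le_0_iff)
  then show ?thesis
    by (rule AE_I') (auto simp: N_def not_less)
qed

lemma AE_summable: "AE \<omega> in M. summable (\<lambda>n. D n \<omega>)"
proof -
  \<comment> \<open>Only countably many radii are used, so their exceptional null sets can be merged
    into one.\<close>
  have "AE \<omega> in M. \<forall>i. \<exists>m. \<forall>k\<ge>m. norm (\<Sum>j\<in>{m..<k}. D j \<omega>) < 1 / real (Suc i)"
    using AE_small_oscillation by (simp add: AE_all_countable)
  then show ?thesis
  proof eventually_elim
    case (elim \<omega>)
    show ?case unfolding summable_Cauchy
    proof (intro allI impI)
      fix e :: real assume "0 < e"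
      \<comment> \<open>Half of \<open>e\<close>, since a block from \<open>k\<close> to
        \<open>l\<close> is the difference of two blocks that start at \<open>m\<close>.\<close>
      then obtain i where i: "1 / real (Suc i) < e / 2"
        using nat_approx_posE[of "e/2"] by auto
      obtain m where m: "\<And>k. k \<ge> m \<Longrightarrow> norm (\<Sum>j\<in>{m..<k}. D j \<omega>) < 1 / real (Suc i)"
        using elim by blast
      have "norm (\<Sum>j\<in>{k..<l}. D j \<omega>) < e" if k: "k \<ge> m" for k l
      proof (cases "k \<le> l")
        case True
        have "(\<Sum>j\<in>{k..<l}. D j \<omega>) = (\<Sum>j\<in>{m..<l}. D j \<omega>) - (\<Sum>j\<in>{m..<k}. D j \<omega>)"
          using sum.atLeastLessThan_concat[OF k True, of "\<lambda>j. D j \<omega>"] by (simp add: algebra_simps)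
        then have "norm (\<Sum>j\<in>{k..<l}. D j \<omega>)
            \<le> norm (\<Sum>j\<in>{m..<l}. D j \<omega>) + norm (\<Sum>j\<in>{m..<k}. D j \<omega>)"
          by (simp add: norm_triangle_ineq4)
        then show ?thesis using m[of k] m[of l] i k True by linarith
      next
        case False
        then show ?thesis using \<open>0 < e\<close> by simp
      qed
      then show "\<exists>N. \<forall>m\<ge>N. \<forall>n. norm (\<Sum>j\<in>{m..<n}. D j \<omega>) < e" by blast
    qed
  qed
qed

section \<open>Mean square convergence and orthogonality of the whole series\<close>

text \<open>Fatou's lemma: the remainder is the almost sure limit of finite blocks starting at
  \<open>n\<close>, whose second moments are all bounded by the same tail. Integrability comes out
  of the same estimate.\<close>

lemma suminf_square_integral:
  shows "integrable M (\<lambda>\<omega>. (norm ((\<Sum>j<n. D j \<omega>) - (\<Sum>j. D j \<omega>)))\<^sup>2)" (is ?int)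
    and "(\<integral>\<omega>. (norm ((\<Sum>j<n. D j \<omega>) - (\<Sum>j. D j \<omega>)))\<^sup>2 \<partial>M) \<le> (\<Sum>j. (c (j + n))\<^sup>2)" (is ?le)
proof -
  let ?R = "\<lambda>\<omega>. (norm ((\<Sum>j<n. D j \<omega>) - (\<Sum>j. D j \<omega>)))\<^sup>2"
  let ?U = "\<lambda>m \<omega>. (norm (\<Sum>j\<in>{n..<m}. D j \<omega>))\<^sup>2"
  let ?s = "\<Sum>j. (c (j + n))\<^sup>2"
  have s0: "0 \<le> ?s"
    by (intro suminf_nonneg summable_ignore_initial_segment summable_squares) auto
  \<comment> \<open>Where the series diverges, \<open>suminf\<close> carries no information; this
    happens only on a null set.\<close>
  have "AE \<omega> in M. ennreal (?R \<omega>) = liminf (\<lambda>m. ennreal (?U m \<omega>))"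
    using AE_summable
  proof eventually_elim
    case (elim \<omega>)
    have "(\<lambda>m. norm ((\<Sum>j<m. D j \<omega>) - (\<Sum>j<n. D j \<omega>)) ^ 2) \<longlonglongrightarrow>
        norm ((\<Sum>j. D j \<omega>) - (\<Sum>j<n. D j \<omega>)) ^ 2"
      by (intro tendsto_intros summable_LIMSEQ elim)
    moreover have "eventually (\<lambda>m. norm ((\<Sum>j<m. D j \<omega>) - (\<Sum>j<n. D j \<omega>)) ^ 2 = ?U m \<omega>) sequentially"
      using eventually_ge_at_top[of n]
    proof eventually_elim
      case (elim m)
      have "(\<Sum>j<m. D j \<omega>) - (\<Sum>j<n. D j \<omega>) = (\<Sum>j\<in>{n..<m}. D j \<omega>)"
        using sum_diff_nat_ivl[of 0 n m "\<lambda>j. D j \<omega>"] elim by (simp add: lessThan_atLeast0)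
      then show ?case by simp
    qed
    ultimately have "(\<lambda>m. ?U m \<omega>) \<longlonglongrightarrow> ?R \<omega>"
      by (subst norm_minus_commute) (rule Lim_transform_eventually)
    then have "(\<lambda>m. ennreal (?U m \<omega>)) \<longlonglongrightarrow> ennreal (?R \<omega>)"
      by (rule tendsto_ennrealI)
    then show ?case
      using lim_imp_Liminf sequentially_bot by metis
  qed
  then have "(\<integral>\<^sup>+\<omega>. ennreal (?R \<omega>) \<partial>M) = (\<integral>\<^sup>+\<omega>. liminf (\<lambda>m. ennreal (?U m \<omega>)) \<partial>M)"
    by (rule nn_integral_cong_AE)
  also have "\<dots> \<le> liminf (\<lambda>m. \<integral>\<^sup>+\<omega>. ennreal (?U m \<omega>) \<partial>M)"
    by (rule nn_integral_liminf) measurable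
  also have "\<dots> \<le> liminf (\<lambda>m::nat. ennreal ?s)"
  proof (intro Liminf_mono always_eventually allI)
    fix m
    have "(\<integral>\<^sup>+\<omega>. ennreal (?U m \<omega>) \<partial>M) = ennreal (\<integral>\<omega>. ?U m \<omega> \<partial>M)"
      by (rule nn_integral_eq_integral[OF partial_sum_square_integral(1)]) simp
    also have "\<dots> \<le> ennreal ?s"
      using partial_sum_square_integral(2)[of n m] sum_squares_le_tail[of n m] by (intro ennreal_leI) linarith
    finally show "(\<integral>\<^sup>+\<omega>. ennreal (?U m \<omega>) \<partial>M) \<le> ennreal ?s" .
  qed
  also have "\<dots> = ennreal ?s"
    by (rule Liminf_const) simp
  finally have le: "(\<integral>\<^sup>+\<omega>. ennreal (?R \<omega>) \<partial>M) \<le> ennreal ?s" .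
  have meas: "?R \<in> borel_measurable M" by measurable
  show int: ?int
    using le meas by (intro integrableI_bounded) (auto intro: le_less_trans)
  have "ennreal (\<integral>\<omega>. ?R \<omega> \<partial>M) = (\<integral>\<^sup>+\<omega>. ennreal (?R \<omega>) \<partial>M)"
    by (rule nn_integral_eq_integral[symmetric, OF int]) simp
  with le have "ennreal (\<integral>\<omega>. ?R \<omega> \<partial>M) \<le> ennreal ?s" by (rule ord_eq_le_trans[rotated])
  then show ?le by (simp only: ennreal_le_iff[OF s0])
qed

text \<open>Orthogonality passes from single increments to the infinite sum because the remainder
  tends to 0 in mean square. The test vector must be known at time 0, as it faces every increment.
  This is the tool for non-degeneracy.\<close>

lemma integral_inner_suminf:
  assumes h: "h \<in> borel_measurable (F 0)" and hb: "AE \<omega> in M. norm (h \<omega>) \<le> C"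
  shows "(\<integral>\<omega>. h \<omega> \<bullet> (\<Sum>j. D j \<omega>) \<partial>M) = 0"
proof -
  define R where "R n \<omega> = (\<Sum>j<n. D j \<omega>) - (\<Sum>j. D j \<omega>)" for n \<omega>
  have hM [measurable]: "h \<in> borel_measurable M" using h measurable_F by blast
  have RM [measurable]: "R n \<in> borel_measurable M" for n unfolding R_def[abs_def] by measurable
  have C0: "0 \<le> C"
  proof -
    have "AE \<omega> in M. 0 \<le> C" using hb by eventually_elim (use norm_ge_zero order_trans in blast)
    then show ?thesis by simp
  qed
  have Rint: "integrable M (\<lambda>\<omega>. (norm (R n \<omega>))\<^sup>2)"
    and Rle: "(\<integral>\<omega>. (norm (R n \<omega>))\<^sup>2 \<partial>M) \<le> (\<Sum>j. (c (j + n))\<^sup>2)" for n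
    unfolding R_def using suminf_square_integral[of n] by auto
  have le: "AE \<omega> in M. (h \<omega> \<bullet> R n \<omega>)\<^sup>2 \<le> C\<^sup>2 * (norm (R n \<omega>))\<^sup>2" for n
    using hb
  proof eventually_elim
    case (elim \<omega>)
    have "\<bar>h \<omega> \<bullet> R n \<omega>\<bar> \<le> norm (h \<omega>) * norm (R n \<omega>)" by (rule Cauchy_Schwarz_ineq2)
    also have "\<dots> \<le> C * norm (R n \<omega>)" using elim by (intro mult_right_mono) auto
    finally have "\<bar>h \<omega> \<bullet> R n \<omega>\<bar>\<^sup>2 \<le> (C * norm (R n \<omega>))\<^sup>2" by (intro power_mono) auto
    then show ?case by (simp add: power_mult_distrib)
  qed
  have sq: "integrable M (\<lambda>\<omega>. (h \<omega> \<bullet> R n \<omega>)\<^sup>2)" for n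
  proof (rule Bochner_Integration.integrable_bound)
    show "integrable M (\<lambda>\<omega>. C\<^sup>2 * (norm (R n \<omega>))\<^sup>2)" using Rint by simp
    show "AE \<omega> in M. norm ((h \<omega> \<bullet> R n \<omega>)\<^sup>2) \<le> norm (C\<^sup>2 * (norm (R n \<omega>))\<^sup>2)"
      using le[of n] by eventually_elim simp
  qed measurable
  have int: "integrable M (\<lambda>\<omega>. h \<omega> \<bullet> R n \<omega>)" for n
    by (rule square_integrable_imp_integrable[OF _ sq]) measurable
  have bound: "(\<integral>\<omega>. h \<omega> \<bullet> R n \<omega> \<partial>M)\<^sup>2 \<le> C\<^sup>2 * (\<Sum>j. (c (j + n))\<^sup>2)" for n
  proof -
    \<comment> \<open>The square of a mean is at most the second moment, because a variance is
      nonnegative.\<close>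
    have "(\<integral>\<omega>. h \<omega> \<bullet> R n \<omega> \<partial>M)\<^sup>2 \<le> (\<integral>\<omega>. (h \<omega> \<bullet> R n \<omega>)\<^sup>2 \<partial>M)"
      using variance_positive[of "\<lambda>\<omega>. h \<omega> \<bullet> R n \<omega>"] variance_eq[OF int sq, of n] by simp
    also have "\<dots> \<le> (\<integral>\<omega>. C\<^sup>2 * (norm (R n \<omega>))\<^sup>2 \<partial>M)"
      by (rule integral_mono_AE[OF sq _ le]) (use Rint in simp)
    also have "\<dots> = C\<^sup>2 * (\<integral>\<omega>. (norm (R n \<omega>))\<^sup>2 \<partial>M)" by simp
    also have "\<dots> \<le> C\<^sup>2 * (\<Sum>j. (c (j + n))\<^sup>2)" by (intro mult_left_mono Rle) simp
    finally show ?thesis .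
  qed
  have Dint: "integrable M (\<lambda>\<omega>. h \<omega> \<bullet> D j \<omega>)" for j
  proof (rule integrable_const_bound[where B="C * c j"])
    show "AE \<omega> in M. norm (h \<omega> \<bullet> D j \<omega>) \<le> C * c j"
      using hb increment_bound[of j]
    proof eventually_elim
      case (elim \<omega>)
      have "norm (h \<omega> \<bullet> D j \<omega>) \<le> norm (h \<omega>) * norm (D j \<omega>)"
        by (simp add: Cauchy_Schwarz_ineq2)
      also have "\<dots> \<le> C * c j" using elim C0 by (intro mult_mono) auto
      finally show ?case .
    qed
  qed measurable
  \<comment> \<open>The integral is the same for all \<open>n\<close>, while its bound tends to 0
    with \<open>n\<close>; hence it is 0. \<open>R 0\<close> is minus the whole series.\<close>
  have const: "(\<integral>\<omega>. h \<omega> \<bullet> R n \<omega> \<partial>M) = (\<integral>\<omega>. h \<omega> \<bullet> R 0 \<omega> \<partial>M)" for n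
  proof -
    have "(\<integral>\<omega>. h \<omega> \<bullet> R n \<omega> \<partial>M) = (\<integral>\<omega>. (\<Sum>j<n. h \<omega> \<bullet> D j \<omega>) + h \<omega> \<bullet> R 0 \<omega> \<partial>M)"
      by (simp add: R_def inner_diff_right inner_sum_right)
    also have "\<dots> = (\<Sum>j<n. \<integral>\<omega>. h \<omega> \<bullet> D j \<omega> \<partial>M) + (\<integral>\<omega>. h \<omega> \<bullet> R 0 \<omega> \<partial>M)"
      using Dint int by simp
    also have "(\<Sum>j<n. \<integral>\<omega>. h \<omega> \<bullet> D j \<omega> \<partial>M) = 0"
      by (intro sum.neutral ballI increment_orthogonal[OF measurable_F_mono[OF h] hb]) simp
    finally show ?thesis by simp
  qed
  have "(\<integral>\<omega>. h \<omega> \<bullet> R 0 \<omega> \<partial>M)\<^sup>2 \<le> C\<^sup>2 * (\<Sum>j. (c (j + n))\<^sup>2)" for n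
    using bound[of n] unfolding const[of n] .
  moreover have "(\<lambda>n. C\<^sup>2 * (\<Sum>j. (c (j + n))\<^sup>2)) \<longlonglongrightarrow> C\<^sup>2 * 0"
    by (intro tendsto_intros tail_squares_tendsto_0)
  ultimately have "(\<integral>\<omega>. h \<omega> \<bullet> R 0 \<omega> \<partial>M)\<^sup>2 \<le> C\<^sup>2 * 0"
    by (intro LIMSEQ_le_const) auto
  then have "(\<integral>\<omega>. h \<omega> \<bullet> R 0 \<omega> \<partial>M) = 0" by simp
  then show ?thesis by (simp add: R_def)
qed

end

section \<open>The step matrices\<close>

type_synonym 'd sqmat = "((real, 'd) vec, 'd) vec"

section \<open>The cyclic successor as a permutation\<close>

text \<open>The position of \<open>i\<close> counted from 0. It turns \<open>cyc_succ\<close>, given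
  through the order, into adding one to a number below d, with a return to 0 at the end.\<close>

definition index_rank :: "'d::{finite,linorder} \<Rightarrow> nat" where
  "index_rank i = card {j. j < i}"

lemma index_rank_strict_mono: "i < j \<Longrightarrow> index_rank i < index_rank j"
  unfolding index_rank_def by (rule psubset_card_mono) auto

lemma index_rank_eq_iff: "index_rank i = index_rank j \<longleftrightarrow> i = j"
  using index_rank_strict_mono[of i j] index_rank_strict_mono[of j i] by (cases i j rule: linorder_cases) auto

lemma index_rank_cyc_succ:
  assumes "\<exists>j. i < j"
  shows "index_rank (cyc_succ i) = Suc (index_rank i)"
proof -
  have eq: "cyc_succ i = Min {j. i < j}"
    using assms by (simp add: cyc_succ_def Least_Min)
  have gt: "i < cyc_succ i"
    using Min_in[of "{j. i < j}"] assms unfolding eq by auto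
  have le: "cyc_succ i \<le> j" if "i < j" for j
    using that unfolding eq by (auto intro!: Min_le)
  have "j < cyc_succ i \<longleftrightarrow> j \<le> i" for j
    using gt le[of j] by (metis le_less_trans not_le)
  then have "{j. j < cyc_succ i} = insert i {j. j < i}"
    by (intro set_eqI) (simp add: le_less disj_commute)
  then show ?thesis by (simp add: index_rank_def)
qed

lemma index_rank_cyc_succ_last:
  assumes "\<not> (\<exists>j. i < j)"
  shows "index_rank (cyc_succ i) = 0"
proof -
  have "cyc_succ i = Min UNIV"
    using assms by (simp add: cyc_succ_def Least_Min)
  then have "{j. j < cyc_succ i} = {}" by (auto simp: not_less)
  then show ?thesis by (simp add: index_rank_def)
qed

text \<open>The last index is the only one whose successor has rank 0; on all other indices the rank
  of the successor determines the rank, hence the index.\<close>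

lemma inj_cyc_succ: "inj (cyc_succ :: 'd::{finite,linorder} \<Rightarrow> 'd)"
proof (rule injI)
  fix i j :: 'd assume eq: "cyc_succ i = cyc_succ j"
  show "i = j"
  proof (cases "(\<exists>k. i < k) \<or> (\<exists>k. j < k)")
    case True
    then have "(\<exists>k. i < k) \<and> (\<exists>k. j < k)"
      using index_rank_cyc_succ index_rank_cyc_succ_last eq by (metis nat.distinct(1))
    then show ?thesis using index_rank_cyc_succ eq by (metis nat.inject index_rank_eq_iff)
  next
    case False
    then show ?thesis by (metis linorder_neqE)
  qed
qed

lemma bij_cyc_succ: "bij (cyc_succ :: 'd::{finite,linorder} \<Rightarrow> 'd)"
  by (simp add: bij_def inj_cyc_succ finite_UNIV_inj_surj)

text \<open>The orbit of the least index visits d different positions before it closes; this is what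
  tells the powers of \<open>cycJ\<close> apart.\<close>

lemma index_rank_funpow_cyc_succ_Min:
  "k < CARD('d) \<Longrightarrow> index_rank ((cyc_succ ^^ k) (Min (UNIV :: 'd::{finite,linorder} set))) = k"
proof (induction k)
  case 0
  have "{j. j < Min (UNIV :: 'd set)} = {}" by (auto simp: leD)
  then show ?case by (simp add: index_rank_def)
next
  case (Suc k)
  define x where "x = (cyc_succ ^^ k) (Min (UNIV :: 'd set))"
  have rx: "index_rank x = k" using Suc by (simp add: x_def)
  have "\<exists>j. x < j"
  proof (rule ccontr)
    assume "\<not> ?thesis"
    then have "{j. j < x} = UNIV - {x}" by (auto simp: neq_iff)
    then have "index_rank x = CARD('d) - 1" by (simp add: index_rank_def card_Diff_singleton)
    then show False using rx Suc by simp
  qed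
  then show ?case using index_rank_cyc_succ[of x] rx by (simp add: x_def)
qed

section \<open>The signed powers of the cyclic matrix\<close>

lemma cycJ_mult_vec: "(cycJ *v x) $ i = x $ cyc_succ i"
  unfolding cycJ_def matrix_vector_mult_def by (simp add: if_distrib[of "\<lambda>c. c * _"] cong: if_cong)

lemma cycJ_pow_mult_vec: "(cycJ_pow k *v x) $ i = x $ (cyc_succ ^^ k) i"
proof (induction k arbitrary: x i)
  case 0
  then show ?case by (simp add: cycJ_pow_def)
next
  case (Suc k)
  have "cycJ_pow (Suc k) *v x = cycJ_pow k *v (cycJ *v x)"
    by (simp add: cycJ_pow_def matrix_vector_mul_assoc)
  then show ?case by (simp add: Suc cycJ_mult_vec)
qed

lemma norm_cycJ_pow_mult_vec: "norm (cycJ_pow k *v x) = norm x"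
proof -
  have "bij ((cyc_succ :: 'a \<Rightarrow> 'a) ^^ k)" using bij_cyc_succ by (rule bij_betw_funpow)
  then have "(\<Sum>i\<in>UNIV. (norm (x $ (cyc_succ ^^ k) i))\<^sup>2) = (\<Sum>i\<in>UNIV. (norm (x $ i))\<^sup>2)"
    by (rule sum.reindex_bij_betw)
  then show ?thesis by (simp add: norm_vec_def L2_set_def cycJ_pow_mult_vec)
qed

lemma cycJ_pow_0: "cycJ_pow 0 = mat 1"
  by (simp add: cycJ_pow_def)

lemma inj_on_cycJ_pow:
  "inj_on (cycJ_pow :: nat \<Rightarrow> 'd::{finite,linorder} sqmat) {..<CARD('d)}"
proof (rule inj_onI)
  fix k l assume k: "k \<in> {..<CARD('d)}" and l: "l \<in> {..<CARD('d)}"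
    and eq: "(cycJ_pow k :: 'd sqmat) = cycJ_pow l"
  let ?m = "Min (UNIV :: 'd set)"
  \<comment> \<open>Equal matrices act equally on one basis vector. It is chosen so that the
    \<open>k\<close>-th power has entry 1 at \<open>?m\<close>; the \<open>l\<close>-th power must
    then have the same entry there.\<close>
  have "axis ((cyc_succ ^^ k) ?m) (1::real) $ (cyc_succ ^^ k) ?m = axis ((cyc_succ ^^ k) ?m) 1 $ (cyc_succ ^^ l) ?m"
    using cycJ_pow_mult_vec[of k _ ?m] cycJ_pow_mult_vec[of l _ ?m] eq by metis
  then have "(cyc_succ ^^ k) ?m = (cyc_succ ^^ l) ?m"
    by (simp add: axis_def split: if_splits)
  then show "k = l" using index_rank_funpow_cyc_succ_Min k l by (metis lessThan_iff)
qed

text \<open>The all-ones vector is fixed by every permutation of the coordinates, so equality would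
  give 1 = -1. The coordinate \<open>undefined\<close> is merely some index.\<close>

lemma cycJ_pow_neq_uminus: "cycJ_pow k \<noteq> - (cycJ_pow l :: 'd::{finite,linorder} sqmat)"
proof
  assume eq: "cycJ_pow k = - (cycJ_pow l :: 'd sqmat)"
  have "cycJ_pow k *v (1::(real, 'd) vec) = - (cycJ_pow l *v 1)"
    by (simp add: eq vec_eq_iff matrix_vector_mult_def sum_negf)
  from arg_cong[OF this, of "\<lambda>v. v $ undefined"] show False
    by (simp add: cycJ_pow_mult_vec)
qed

text \<open>The possible values of \<open>A n\<close> form a set closed under negation;
  \<open>mat 1\<close> and \<open>- mat 1\<close> are the case of exponent 0. Counting and summation
  both rest on this symmetric form.\<close>

lemma step_mats_eq:
  "insert (mat 1) other_mats = (cycJ_pow ` {..<CARD('d)} \<union> uminus ` cycJ_pow ` {..<CARD('d)}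
      :: ('d::{finite,linorder} sqmat) set)"
proof -
  have "{..<CARD('d)} = insert 0 {k. 1 \<le> k \<and> k \<le> CARD('d) - 1}"
    by (auto simp: Suc_le_eq)
  then show ?thesis
    unfolding other_mats_def by (auto simp: cycJ_pow_0)
qed

lemma finite_step_mats: "finite (insert (mat 1) other_mats :: ('d::{finite,linorder} sqmat) set)"
  unfolding step_mats_eq by simp

lemma mat_1_notin_other_mats: "mat 1 \<notin> (other_mats :: ('d::{finite,linorder} sqmat) set)"
proof -
  have "(mat 1 :: 'd sqmat) \<noteq> cycJ_pow k" if k: "1 \<le> k" "k \<le> CARD('d) - 1" for k
  proof -
    have "k < CARD('d)" using k by linarith
    then show ?thesis
      using k inj_on_cycJ_pow[where 'd='d, THEN inj_onD, of 0 k] by (auto simp: cycJ_pow_0)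
  qed
  moreover have "(mat 1 :: 'd sqmat) \<noteq> - cycJ_pow l" for l
    using cycJ_pow_neq_uminus[where k=0 and l=l and 'd='d] by (simp add: cycJ_pow_0)
  moreover have "(mat 1 :: 'd sqmat) \<noteq> - mat 1"
    using cycJ_pow_neq_uminus[where k=0 and l=0 and 'd='d] by (simp add: cycJ_pow_0)
  ultimately show ?thesis
    unfolding other_mats_def by auto
qed

lemma step_mats_disjoint:
  "cycJ_pow ` K \<inter> uminus ` cycJ_pow ` K = ({} :: ('d::{finite,linorder} sqmat) set)"
  by (auto simp: cycJ_pow_neq_uminus)

text \<open>Distinctness of the 2d signed powers is what makes the prescribed probabilities of
  \<open>A n\<close> add up to 1.\<close>

lemma card_other_mats:
  "real (card (other_mats :: ('d::{finite,linorder} sqmat) set)) = 2 * real CARD('d) - 1"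
proof -
  have "card (insert (mat 1) other_mats :: ('d sqmat) set) = 2 * CARD('d)"
    unfolding step_mats_eq
    by (subst card_Un_disjoint) (auto simp: step_mats_disjoint card_image inj_on_cycJ_pow)
  then show ?thesis
    using finite_step_mats[where 'd='d] mat_1_notin_other_mats[where 'd='d] by (simp add: card_insert_disjoint)
qed

text \<open>The symmetric set sums to 0, and removing the identity leaves its negative unpaired.
  This is the origin of the subtracted term in \<open>a_eq\<close>.\<close>

lemma sum_other_mats: "\<Sum>other_mats = (- mat 1 :: 'd::{finite,linorder} sqmat)"
proof -
  have "mat 1 + \<Sum>other_mats = (\<Sum>B\<in>insert (mat 1) other_mats. (B :: 'd sqmat))"
    using finite_step_mats[where 'd='d] mat_1_notin_other_mats[where 'd='d] by simp
  also have "\<dots> = 0"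
    unfolding step_mats_eq
    by (subst sum.union_disjoint) (auto simp: step_mats_disjoint sum.reindex sum_negf)
  finally show ?thesis by (simp add: eq_neg_iff_add_eq_0 add.commute)
qed

lemma sum_other_mats_mult_vec:
  "(\<Sum>B\<in>other_mats. B *v x) = - (x :: (real, 'd::{finite,linorder}) vec)"
proof -
  have "(\<Sum>B\<in>S. B *v x) = \<Sum>S *v x" for S :: "'d sqmat set"
    by (induction S rule: infinite_finite_induct) (auto simp: matrix_vector_mult_add_rdistrib)
  then have "(\<Sum>B\<in>other_mats. B *v x) = (- mat 1) *v x"
    by (simp add: sum_other_mats)
  also have "\<dots> = - (mat 1 *v x)"
    by (simp add: vec_eq_iff matrix_vector_mult_def sum_negf)
  finally show ?thesis by simp
qed

lemma norm_step_mat_mult_vec: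
  assumes "B \<in> insert (mat 1) other_mats"
  shows "norm (B *v (x :: (real, 'd::{finite,linorder}) vec)) = norm x"
proof -
  have neg: "(- C) *v x = - (C *v x)" for C :: "'d sqmat"
    by (simp add: vec_eq_iff matrix_vector_mult_def sum_negf)
  show ?thesis
    using assms unfolding step_mats_eq by (auto simp: neg norm_cycJ_pow_mult_vec)
qed

lemma finite_signed_basis: "finite (signed_basis :: (real^'d::finite) set)"
  unfolding signed_basis_def by (simp add: full_SetCompr_eq)

lemma card_signed_basis: "card (signed_basis :: (real^'d::finite) set) = 2 * CARD('d)"
proof -
  have card: "card (range (\<lambda>i::'d. axis i c)) = CARD('d)" if "c \<noteq> 0" for c :: real
    using that by (intro card_image injI) (simp add: axis_eq_axis)
  have "signed_basis = range (\<lambda>i::'d. axis i (1::real)) \<union> range (\<lambda>i. axis i (-1))"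
    by (auto simp: signed_basis_def)
  moreover have "range (\<lambda>i::'d. axis i (1::real)) \<inter> range (\<lambda>i. axis i (-1)) = {}"
    by (auto simp: axis_eq_axis)
  ultimately have "card (signed_basis :: (real^'d) set)
      = card (range (\<lambda>i::'d. axis i (1::real))) + card (range (\<lambda>i::'d. axis i (-1::real)))"
    by (metis card_Un_disjoint finite_imageI finite_class.finite_UNIV)
  then show ?thesis by (simp add: card)
qed

lemma norm_signed_basis: "v \<in> signed_basis \<Longrightarrow> norm v = 1"
  by (auto simp: signed_basis_def norm_eq_1 inner_axis_axis)

section \<open>The normalising weights\<close>

definition weight :: "real \<Rightarrow> nat \<Rightarrow> real" where
  "weight a n = a * fact (n - 1) / pochhammer a n"

lemma weight_1: "0 < a \<Longrightarrow> weight a 1 = 1"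
  by (simp add: weight_def)

lemma weight_pos: "0 < a \<Longrightarrow> 0 < weight a n"
  by (simp add: weight_def pochhammer_pos)

lemma weight_Suc:
  assumes "0 < a" "n \<ge> 1"
  shows "weight a (Suc n) * (1 + a / real n) = weight a n"
proof -
  obtain m where m: "n = Suc m" using assms(2) by (cases n) auto
  have pos: "a + real n > 0" "real n > 0" using assms by auto
  have "weight a (Suc n) = a * (real n * fact (n - 1)) / (pochhammer a n * (a + real n))"
    by (simp add: weight_def pochhammer_Suc m)
  then have "weight a (Suc n) = weight a n * (real n / (a + real n))"
    by (simp add: weight_def)
  moreover have "1 + a / real n = (a + real n) / real n"
    using pos by (simp add: field_simps)
  ultimately show ?thesis using pos by simp
qed

text \<open>Up to the factor \<open>a\<close> the sequence is a form of Gauss's product for the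
  Gamma function; the index 0 is excluded because \<open>powr\<close> has a special value at base
  0.\<close>

lemma weight_asymptotics: "(\<lambda>n. weight a n * real n powr a) \<longlonglongrightarrow> a * Gamma a"
proof -
  have "(\<lambda>n. a * Gamma_series' a n) \<longlonglongrightarrow> a * Gamma a"
    by (intro tendsto_intros Gamma_series'_LIMSEQ)
  moreover have "eventually (\<lambda>n. a * Gamma_series' a n = weight a n * real n powr a) sequentially"
    using eventually_gt_at_top[of 0]
    by eventually_elim (simp add: Gamma_series'_def weight_def powr_def)
  ultimately show ?thesis by (rule Lim_transform_eventually)
qed

lemma summable_weight_squares:
  assumes a: "1 / 2 < a"
  shows "summable (\<lambda>n. (weight a n)\<^sup>2)"
proof (rule summable_comparison_test_ev)
  have "eventually (\<lambda>n. weight a n * real n powr a < a * Gamma a + 1) sequentially"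
    using order_tendstoD(2)[OF weight_asymptotics] by simp
  then show "eventually (\<lambda>n. norm ((weight a n)\<^sup>2) \<le> (a * Gamma a + 1)\<^sup>2 * real n powr (-2 * a)) sequentially"
    using eventually_gt_at_top[of 0]
  proof eventually_elim
    case (elim n)
    have "(weight a n)\<^sup>2 = (weight a n * real n powr a)\<^sup>2 * real n powr (-2 * a)"
      using elim(2) by (simp add: power2_eq_square powr_minus powr_add[symmetric] field_simps)
    also have "\<dots> \<le> (a * Gamma a + 1)\<^sup>2 * real n powr (-2 * a)"
      using elim(1) weight_pos[of a n] a by (intro mult_right_mono power_mono) auto
    finally show ?case by simp
  qed
  show "summable (\<lambda>n. (a * Gamma a + 1)\<^sup>2 * real n powr (-2 * a))"
    using a by (intro summable_mult) (simp add: summable_real_powr_iff)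
qed

section \<open>The elephant random walk\<close>

lemma norm_add_square_le: "(norm (x + y))\<^sup>2 \<le> 2 * (norm x)\<^sup>2 + 2 * (norm (y::'c::real_normed_vector))\<^sup>2"
proof -
  have "(norm (x + y))\<^sup>2 \<le> (norm x + norm y)\<^sup>2"
    by (intro power_mono norm_triangle_ineq) auto
  also have "\<dots> \<le> 2 * (norm x)\<^sup>2 + 2 * (norm y)\<^sup>2"
    using sum_squares_bound[of "norm x" "norm y"] by (simp add: power2_sum)
  finally show ?thesis .
qed

text \<open>Only point masses are assumed for the first step, \<open>b n\<close> and
  \<open>A n\<close>. As they add up to 1, other values occur with probability 0.\<close>

lemma (in prob_space) AE_in_finite_support:
  assumes "finite V" and ev: "\<And>v. v \<in> V \<Longrightarrow> {\<omega>\<in>space M. Z \<omega> = v} \<in> events"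
    and one: "(\<Sum>v\<in>V. prob {\<omega>\<in>space M. Z \<omega> = v}) = 1"
  shows "AE \<omega> in M. Z \<omega> \<in> V"
proof -
  have "prob (\<Union>v\<in>V. {\<omega>\<in>space M. Z \<omega> = v}) = 1"
    using assms by (subst finite_measure_finite_Union) (auto simp: disjoint_family_on_def)
  then have "AE \<omega> in M. \<omega> \<in> (\<Union>v\<in>V. {\<omega>\<in>space M. Z \<omega> = v})"
    by (rule AE_prob_1)
  then show ?thesis by eventually_elim auto
qed

locale elephant_walk = prob_space M
  for M :: "'a measure" +
  fixes p :: real
    and X :: "nat \<Rightarrow> 'a \<Rightarrow> real^('d::{finite,linorder})"
    and b :: "nat \<Rightarrow> 'a \<Rightarrow> nat"
    and A :: "nat \<Rightarrow> 'a \<Rightarrow> real^('d::{finite,linorder})^('d::{finite,linorder})"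
  assumes p_gt: "(2 * real CARD('d) + 1) / (4 * real CARD('d)) < p"
    and p_le: "p \<le> 1"
    and X_meas: "\<And>k. k \<ge> 1 \<Longrightarrow> X k \<in> borel_measurable M"
    and b_meas: "\<And>n. n \<ge> 1 \<Longrightarrow> b n \<in> measurable M (count_space UNIV)"
    and A_meas: "\<And>n. n \<ge> 1 \<Longrightarrow> A n \<in> borel_measurable M"
    and X1_law: "\<And>v. v \<in> signed_basis \<Longrightarrow>
        prob {\<omega> \<in> space M. X 1 \<omega> = v} = 1 / (2 * real CARD('d))"
    and b_law: "\<And>n k. n \<ge> 1 \<Longrightarrow> k \<in> {1..n} \<Longrightarrow>
        prob {\<omega> \<in> space M. b n \<omega> = k} = 1 / real n"
    and A_law_id: "\<And>n. n \<ge> 1 \<Longrightarrow> prob {\<omega> \<in> space M. A n \<omega> = mat 1} = p"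
    and A_law_other: "\<And>n B. n \<ge> 1 \<Longrightarrow> B \<in> other_mats \<Longrightarrow>
        prob {\<omega> \<in> space M. A n \<omega> = B} = (1 - p) / (2 * real CARD('d) - 1)"
    and indep: "\<And>n. n \<ge> 1 \<Longrightarrow>
        indep_sets
          (\<lambda>i::nat. if i = 0 then sets (vimage_algebra (space M) (b n) (count_space UNIV))
                 else if i = 1 then sets (vimage_algebra (space M) (A n) borel)
                 else sets (vimage_algebra (space M) (\<lambda>\<omega>. restrict (\<lambda>k. X k \<omega>) {1..n})
                                         (\<Pi>\<^sub>M k\<in>{1..n}. borel)))
          {0, 1, 2}"
    and step: "\<And>n \<omega>. n \<ge> 1 \<Longrightarrow> \<omega> \<in> space M \<Longrightarrow>
        X (Suc n) \<omega> = A n \<omega> *v X (b n \<omega>) \<omega>"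
begin

definition S :: "nat \<Rightarrow> 'a \<Rightarrow> real^('d::{finite,linorder})" where
  "S n \<omega> = (\<Sum>k\<in>{1..n}. X k \<omega>)"

definition a :: real where
  "a = (2 * real CARD('d) * p - 1) / (2 * real CARD('d) - 1)"

definition past :: "nat \<Rightarrow> 'a measure" where
  "past n = vimage_algebra (space M) (\<lambda>\<omega>. restrict (\<lambda>k. X k \<omega>) {1..n}) (\<Pi>\<^sub>M k\<in>{1..n}. borel)"

lemma card_ge_1: "1 \<le> real CARD('d)"
  using zero_less_card_finite[where 'a='d] by linarith

lemma a_gt_half: "1 / 2 < a"
  and a_le_1: "a \<le> 1"
  and a_eq: "a = p - (1 - p) / (2 * real CARD('d) - 1)"
proof -
  define d where "d = real CARD('d)"
  have "1 \<le> d" using card_ge_1 unfolding d_def .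
  then have d: "1 \<le> d" "0 < 2 * d - 1" by linarith+
  have "2 * d + 1 < 4 * d * p"
    using p_gt d unfolding d_def[symmetric] by (simp add: pos_divide_less_eq mult.commute)
  then show "1 / 2 < a"
    using d unfolding a_def d_def[symmetric] by (simp add: pos_less_divide_eq)
  have "2 * d * p \<le> 2 * d * 1"
    using d p_le by (intro mult_left_mono) auto
  then show "a \<le> 1"
    using d unfolding a_def d_def[symmetric] by (simp add: pos_divide_le_eq)
  show "a = p - (1 - p) / (2 * real CARD('d) - 1)"
    using d unfolding a_def d_def[symmetric] by (simp add: field_simps)
qed

section \<open>The natural filtration of the walk\<close>

lemma space_past: "space (past n) = space M"
  by (simp add: past_def)

lemma X_past: "k \<in> {1..n} \<Longrightarrow> X k \<in> borel_measurable (past n)"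
proof -
  assume k: "k \<in> {1..n}"
  have "(\<lambda>\<omega>. restrict (\<lambda>k. X k \<omega>) {1..n}) \<in> measurable (past n) (\<Pi>\<^sub>M k\<in>{1..n}. borel)"
    unfolding past_def by (rule measurable_vimage_algebra1) (auto simp: space_PiM)
  from measurable_compose[OF this measurable_component_singleton[OF k]]
  show ?thesis by (simp only: restrict_apply k if_True)
qed

lemma past_subset:
  assumes "space N = space M" "\<And>k. k \<in> {1..n} \<Longrightarrow> X k \<in> borel_measurable N"
  shows "sets (past n) \<subseteq> sets N"
  unfolding past_def using assms by (intro sets_image_in_sets measurable_restrict) auto

lemma past_subalgebra: "subalgebra M (past n)"
  unfolding subalgebra_def using past_subset[of M n] X_meas by (auto simp: space_past)

lemma past_Suc: "sets (past n) \<subseteq> sets (past (Suc n))"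
  using X_past by (intro past_subset) (auto simp: space_past)

lemma S_past: "n \<le> m \<Longrightarrow> S n \<in> borel_measurable (past m)"
  unfolding S_def[abs_def] by (intro borel_measurable_sum X_past) auto

lemma S_measurable [measurable]: "S n \<in> borel_measurable M"
  using S_past[of n n] measurable_from_subalg[OF past_subalgebra] by blast

lemma event_A: "n \<ge> 1 \<Longrightarrow> {\<omega>\<in>space M. A n \<omega> = B} \<in> events"
  using A_meas[of n] by measurable

lemma event_b: "n \<ge> 1 \<Longrightarrow> {\<omega>\<in>space M. b n \<omega> = k} \<in> events"
  using b_meas[of n] by measurable

lemma event_X: "n \<ge> 1 \<Longrightarrow> {\<omega>\<in>space M. X n \<omega> = v} \<in> events"
  using X_meas[of n] by measurable

lemma indicator_b_measurable:
  "n \<ge> 1 \<Longrightarrow> (\<lambda>\<omega>. indicator {k} (b n \<omega>) :: real) \<in> borel_measurable M"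
  by (rule measurable_compose[OF b_meas]) auto

lemma indicator_A_measurable:
  "n \<ge> 1 \<Longrightarrow> (\<lambda>\<omega>. indicator {B} (A n \<omega>) :: real) \<in> borel_measurable M"
  by (rule measurable_compose[OF A_meas]) auto

section \<open>Almost sure ranges and norms\<close>

lemma AE_X1: "AE \<omega> in M. X 1 \<omega> \<in> signed_basis"
proof (intro AE_in_finite_support finite_signed_basis event_X)
  have "(\<Sum>v\<in>signed_basis. prob {\<omega>\<in>space M. X 1 \<omega> = v})
      = (\<Sum>v\<in>(signed_basis :: (real, 'd) vec set). 1 / (2 * real CARD('d)))"
    by (intro sum.cong refl X1_law)
  then show "(\<Sum>v\<in>signed_basis. prob {\<omega>\<in>space M. X 1 \<omega> = v}) = 1"
    by (simp add: card_signed_basis)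
qed simp

lemma AE_A:
  assumes n: "n \<ge> 1"
  shows "AE \<omega> in M. A n \<omega> \<in> insert (mat 1) other_mats"
proof (intro AE_in_finite_support finite_step_mats event_A n)
  have "2 * real CARD('d) - 1 \<noteq> 0" using card_ge_1 by linarith
  then show "(\<Sum>B\<in>insert (mat 1) other_mats. prob {\<omega>\<in>space M. A n \<omega> = B}) = 1"
    using n mat_1_notin_other_mats[where 'd='d] finite_step_mats[where 'd='d]
    by (simp add: A_law_id A_law_other card_other_mats)
qed

lemma AE_b: "n \<ge> 1 \<Longrightarrow> AE \<omega> in M. b n \<omega> \<in> {1..n}"
  by (intro AE_in_finite_support event_b) (simp_all add: b_law)

text \<open>Every step matrix is an isometry. The induction is strong because \<open>b n\<close> may
  select any earlier step.\<close>

lemma AE_norm_X: "n \<ge> 1 \<Longrightarrow> AE \<omega> in M. norm (X n \<omega>) = 1"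
proof (induction n rule: less_induct)
  case (less n)
  show ?case
  proof (cases "n = 1")
    case True
    then show ?thesis using AE_X1 norm_signed_basis by (auto elim!: eventually_mono)
  next
    case False
    then obtain m where m: "n = Suc m" "m \<ge> 1" using less.prems by (cases n) auto
    have "AE \<omega> in M. \<forall>k\<in>{1..m}. norm (X k \<omega>) = 1"
      using less.IH m by (intro AE_finite_allI) auto
    then show ?thesis
      using AE_A[OF m(2)] AE_b[OF m(2)] AE_space
    proof eventually_elim
      case (elim \<omega>)
      then show ?case using m by (simp only: step norm_step_mat_mult_vec)
    qed
  qed
qed

lemma AE_norm_S: "AE \<omega> in M. norm (S n \<omega>) \<le> real n"
proof -
  have "AE \<omega> in M. \<forall>k\<in>{1..n}. norm (X k \<omega>) = 1"
    using AE_norm_X by (intro AE_finite_allI) auto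
  then show ?thesis
  proof eventually_elim
    case (elim \<omega>)
    then show ?case
      using sum_norm_bound[of "{1..n}" "\<lambda>k. X k \<omega>" 1] by (simp add: S_def)
  qed
qed

section \<open>Mean of the next step given the past\<close>

lemma integral_indep_product:
  assumes n: "n \<ge> 1" and f: "f \<in> borel_measurable (past n)" and int: "integrable M f"
  shows "(\<integral>\<omega>. indicator {k} (b n \<omega>) * (indicator {B} (A n \<omega>) * f \<omega>) \<partial>M)
    = prob {\<omega>\<in>space M. b n \<omega> = k} * (prob {\<omega>\<in>space M. A n \<omega> = B} * (\<integral>\<omega>. f \<omega> \<partial>M))" (is ?eq)
    and "integrable M (\<lambda>\<omega>. indicator {k} (b n \<omega>) * (indicator {B} (A n \<omega>) * f \<omega>))" (is ?int)
proof -
  \<comment> \<open>Indices 0, 1, 2 match those in the independence hypothesis: chosen time, chosen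
    matrix, past.\<close>
  define Y :: "nat \<Rightarrow> 'a \<Rightarrow> real" where "Y i = (if i = 0 then (\<lambda>\<omega>. indicator {k} (b n \<omega>))
      else if i = 1 then (\<lambda>\<omega>. indicator {B} (A n \<omega>)) else f)" for i
  define G where "G i = (if i = 0 then vimage_algebra (space M) (b n) (count_space UNIV)
      else if i = 1 then vimage_algebra (space M) (A n) borel else past n)" for i :: nat
  have space_G: "space (G i) = space M" for i by (simp add: G_def space_past)
  have [measurable]: "b n \<in> measurable M (count_space UNIV)" "A n \<in> borel_measurable M"
    using b_meas A_meas n by auto
  have fM: "f \<in> borel_measurable M"
    using f measurable_from_subalg[OF past_subalgebra] by blast
  have b': "b n \<in> measurable (G 0) (count_space UNIV)"
    unfolding G_def by (simp add: measurable_vimage_algebra1)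
  have A': "A n \<in> measurable (G 1) borel"
    unfolding G_def by (simp add: measurable_vimage_algebra1)
  have YG: "Y i \<in> borel_measurable (G i)" if "i \<in> {0,1,2}" for i
    using that b' A' f
    by (auto simp: Y_def G_def[of 2] intro!: measurable_compose[OF b'] measurable_compose[OF A'])
  have YM: "Y i \<in> borel_measurable M" for i
    unfolding Y_def using fM indicator_b_measurable[OF n] indicator_A_measurable[OF n] by simp
  have indG: "indep_sets (\<lambda>i. sets (G i)) {0,1,2}"
    using indep[OF n] unfolding G_def past_def by (simp add: if_distrib[of sets] cong: if_cong)
  have "indep_vars (\<lambda>_. borel) Y {0,1,2}"
    unfolding indep_vars_def2
  proof (intro conjI ballI YM indep_sets_mono_sets[OF indG])
    fix i :: nat assume "i \<in> {0,1,2}"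
    then show "{Y i -` U \<inter> space M |U. U \<in> sets borel} \<subseteq> sets (G i)"
      using measurable_sets[OF YG, of i] by (auto simp: space_G)
  qed
  moreover have Yint: "integrable M (Y i)" if "i \<in> {0,1,2}" for i
  proof (cases "i = 2")
    case False
    show ?thesis
      by (rule integrable_const_bound[where B=1])
        (use False that YM[of i] in \<open>auto simp: Y_def indicator_def\<close>)
  qed (use int in \<open>simp add: Y_def\<close>)
  ultimately have prod: "(\<integral>\<omega>. (\<Prod>i\<in>{0,1,2}. Y i \<omega>) \<partial>M) = (\<Prod>i\<in>{0,1,2}. \<integral>\<omega>. Y i \<omega> \<partial>M)"
    and pint: "integrable M (\<lambda>\<omega>. \<Prod>i\<in>{0,1,2}. Y i \<omega>)"
    using indep_vars_lebesgue_integral[of "{0,1,2}" Y] indep_vars_integrable[of "{0,1,2}" Y] by auto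
  have Yprod: "(\<Prod>i\<in>{0,1,2}. Y i \<omega>) = indicator {k} (b n \<omega>) * (indicator {B} (A n \<omega>) * f \<omega>)" for \<omega>
    by (simp add: Y_def)
  show ?int using pint unfolding Yprod .
  have "(\<integral>\<omega>. Y 0 \<omega> \<partial>M) = (\<integral>\<omega>. indicator {\<omega>\<in>space M. b n \<omega> = k} \<omega> \<partial>M)"
    by (intro Bochner_Integration.integral_cong) (auto simp: Y_def indicator_def)
  moreover have "(\<integral>\<omega>. Y 1 \<omega> \<partial>M) = (\<integral>\<omega>. indicator {\<omega>\<in>space M. A n \<omega> = B} \<omega> \<partial>M)"
    by (intro Bochner_Integration.integral_cong) (auto simp: Y_def indicator_def)
  moreover have "(\<integral>\<omega>. Y 2 \<omega> \<partial>M) = (\<integral>\<omega>. f \<omega> \<partial>M)"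
    by (simp add: Y_def)
  ultimately show ?eq
    using prod event_A[OF n, of B] event_b[OF n, of k] unfolding Yprod by simp
qed

text \<open>The conditional expectation of \<open>X (Suc n)\<close> given the past is \<open>(a / n) S n\<close>, expressed by testing
  against bounded \<open>past n\<close>-measurable vectors.\<close>

lemma integral_inner_X_Suc:
  assumes n: "n \<ge> 1" and h: "h \<in> borel_measurable (past n)"
    and hb: "AE \<omega> in M. norm (h \<omega>) \<le> C"
  shows "(\<integral>\<omega>. h \<omega> \<bullet> X (Suc n) \<omega> \<partial>M) = (a / real n) * (\<integral>\<omega>. h \<omega> \<bullet> S n \<omega> \<partial>M)"
proof -
  let ?mats = "insert (mat 1) other_mats :: 'd sqmat set"
  define f where "f B k \<omega> = h \<omega> \<bullet> (B *v X k \<omega>)" for B k \<omega>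
  have hM [measurable]: "h \<in> borel_measurable M"
    using h measurable_from_subalg[OF past_subalgebra] by blast
  have fp: "f B k \<in> borel_measurable (past n)" if k: "k \<in> {1..n}" for B k
  proof -
    have "(\<lambda>x. B *v x) \<in> borel_measurable borel"
      by (intro borel_measurable_continuous_onI linear_continuous_on
          linear_conv_bounded_linear[THEN iffD1] matrix_vector_mul_linear)
    then have "(\<lambda>\<omega>. B *v X k \<omega>) \<in> borel_measurable (past n)"
      using measurable_compose[OF X_past[OF k]] by blast
    then show ?thesis unfolding f_def[abs_def] using h by (intro borel_measurable_inner)
  qed
  have fM: "f B k \<in> borel_measurable M" if "k \<in> {1..n}" for B k
    using fp[OF that] measurable_from_subalg[OF past_subalgebra] by blast
  have fint: "integrable M (f B k)" if B: "B \<in> ?mats" and k: "k \<in> {1..n}" for B k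
  proof (rule integrable_const_bound[OF _ fM[OF k]])
    have k1: "k \<ge> 1" using k by simp
    show "AE \<omega> in M. norm (f B k \<omega>) \<le> C"
      using hb AE_norm_X[OF k1]
    proof eventually_elim
      case (elim \<omega>)
      have "norm (f B k \<omega>) \<le> norm (h \<omega>) * norm (B *v X k \<omega>)"
        by (simp add: f_def Cauchy_Schwarz_ineq2)
      then show ?case using elim k B by (simp add: norm_step_mat_mult_vec)
    qed
  qed
  \<comment> \<open>Splitting by the values of \<open>b n\<close> and \<open>A n\<close> leaves
    almost surely one surviving summand, and each summand is a product to which independence
    applies.\<close>
  have "(\<integral>\<omega>. h \<omega> \<bullet> X (Suc n) \<omega> \<partial>M) = (\<integral>\<omega>. (\<Sum>k\<in>{1..n}. \<Sum>B\<in>?mats.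
      indicator {k} (b n \<omega>) * (indicator {B} (A n \<omega>) * f B k \<omega>)) \<partial>M)"
  proof (rule integral_cong_AE)
    show "(\<lambda>\<omega>. h \<omega> \<bullet> X (Suc n) \<omega>) \<in> borel_measurable M"
      using X_meas[of "Suc n"] by simp
    show "(\<lambda>\<omega>. \<Sum>k\<in>{1..n}. \<Sum>B\<in>?mats. indicator {k} (b n \<omega>) * (indicator {B} (A n \<omega>) * f B k \<omega>))
        \<in> borel_measurable M"
      by (intro borel_measurable_sum borel_measurable_times fM
          indicator_b_measurable[OF n] indicator_A_measurable[OF n])
    show "AE \<omega> in M. h \<omega> \<bullet> X (Suc n) \<omega> = (\<Sum>k\<in>{1..n}. \<Sum>B\<in>?mats.
        indicator {k} (b n \<omega>) * (indicator {B} (A n \<omega>) * f B k \<omega>))"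
      using AE_A[OF n] AE_b[OF n] AE_space
    proof eventually_elim
      case (elim \<omega>)
      have "(\<Sum>k\<in>{1..n}. \<Sum>B\<in>?mats. indicator {k} (b n \<omega>) * (indicator {B} (A n \<omega>) * f B k \<omega>))
          = (\<Sum>k\<in>{1..n}. if b n \<omega> = k then (\<Sum>B\<in>?mats. if A n \<omega> = B then f B k \<omega> else 0) else 0)"
        by (intro sum.cong refl) (auto simp: indicator_def intro!: sum.cong)
      also have "\<dots> = f (A n \<omega>) (b n \<omega>) \<omega>"
        using elim finite_step_mats[where 'd='d] by (simp only: sum.delta' finite_atLeastAtMost if_True)
      finally show ?case using step[OF n] elim by (simp add: f_def)
    qed
  qed
  also have "\<dots> = (\<Sum>k\<in>{1..n}. \<integral>\<omega>. (\<Sum>B\<in>?mats.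
      indicator {k} (b n \<omega>) * (indicator {B} (A n \<omega>) * f B k \<omega>)) \<partial>M)"
    by (intro Bochner_Integration.integral_sum Bochner_Integration.integrable_sum
        integral_indep_product(2)[OF n] fp fint)
  also have "\<dots> = (\<Sum>k\<in>{1..n}. \<Sum>B\<in>?mats.
      (\<integral>\<omega>. indicator {k} (b n \<omega>) * (indicator {B} (A n \<omega>) * f B k \<omega>) \<partial>M))"
    by (intro sum.cong refl Bochner_Integration.integral_sum
        integral_indep_product(2)[OF n] fp fint)
  also have "\<dots> = (\<Sum>k\<in>{1..n}. (a / real n) * (\<integral>\<omega>. h \<omega> \<bullet> X k \<omega> \<partial>M))"
  proof (intro sum.cong refl)
    fix k assume k: "k \<in> {1..n}"
    have "(\<Sum>B\<in>other_mats. \<integral>\<omega>. f B k \<omega> \<partial>M) = (\<integral>\<omega>. (\<Sum>B\<in>other_mats. f B k \<omega>) \<partial>M)"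
      using fint[OF _ k] by (intro Bochner_Integration.integral_sum[symmetric]) auto
    also have "\<dots> = - (\<integral>\<omega>. h \<omega> \<bullet> X k \<omega> \<partial>M)"
      by (simp add: f_def inner_sum_right[symmetric] sum_other_mats_mult_vec)
    finally have other: "(\<Sum>B\<in>other_mats. \<integral>\<omega>. f B k \<omega> \<partial>M) = - (\<integral>\<omega>. h \<omega> \<bullet> X k \<omega> \<partial>M)" .
    have "(\<Sum>B\<in>?mats. (\<integral>\<omega>. indicator {k} (b n \<omega>) * (indicator {B} (A n \<omega>) * f B k \<omega>) \<partial>M))
        = (\<Sum>B\<in>?mats. (1 / real n) * (prob {\<omega>\<in>space M. A n \<omega> = B} * (\<integral>\<omega>. f B k \<omega> \<partial>M)))"
      by (intro sum.cong refl) (simp only: integral_indep_product(1)[OF n fp fint] k b_law[OF n k])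
    also have "\<dots> = (1 / real n) * (\<Sum>B\<in>?mats. prob {\<omega>\<in>space M. A n \<omega> = B} * (\<integral>\<omega>. f B k \<omega> \<partial>M))"
      by (rule sum_distrib_left[symmetric])
    also have "(\<Sum>B\<in>?mats. prob {\<omega>\<in>space M. A n \<omega> = B} * (\<integral>\<omega>. f B k \<omega> \<partial>M))
        = p * (\<integral>\<omega>. f (mat 1) k \<omega> \<partial>M)
          + (\<Sum>B\<in>other_mats. prob {\<omega>\<in>space M. A n \<omega> = B} * (\<integral>\<omega>. f B k \<omega> \<partial>M))"
      using finite_step_mats[where 'd='d] mat_1_notin_other_mats[where 'd='d]
      by (subst sum.insert) (auto simp: A_law_id[OF n])
    also have "(\<Sum>B\<in>other_mats. prob {\<omega>\<in>space M. A n \<omega> = B} * (\<integral>\<omega>. f B k \<omega> \<partial>M))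
        = (1 - p) / (2 * real CARD('d) - 1) * (\<Sum>B\<in>other_mats. \<integral>\<omega>. f B k \<omega> \<partial>M)"
      by (simp add: A_law_other[OF n] sum_distrib_left)
    also have "p * (\<integral>\<omega>. f (mat 1) k \<omega> \<partial>M) + \<dots> = a * (\<integral>\<omega>. h \<omega> \<bullet> X k \<omega> \<partial>M)"
      unfolding other a_eq by (simp add: f_def left_diff_distrib)
    finally show "(\<Sum>B\<in>?mats. (\<integral>\<omega>. indicator {k} (b n \<omega>) * (indicator {B} (A n \<omega>) * f B k \<omega>) \<partial>M))
        = (a / real n) * (\<integral>\<omega>. h \<omega> \<bullet> X k \<omega> \<partial>M)" by simp
  qed
  also have "\<dots> = (a / real n) * (\<integral>\<omega>. (\<Sum>k\<in>{1..n}. h \<omega> \<bullet> X k \<omega>) \<partial>M)"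
  proof -
    have "integrable M (\<lambda>\<omega>. h \<omega> \<bullet> X k \<omega>)" if "k \<in> {1..n}" for k
      using fint[OF insertI1 that] by (simp add: f_def[abs_def])
    then have "(\<integral>\<omega>. (\<Sum>k\<in>{1..n}. h \<omega> \<bullet> X k \<omega>) \<partial>M) = (\<Sum>k\<in>{1..n}. \<integral>\<omega>. h \<omega> \<bullet> X k \<omega> \<partial>M)"
      by (rule Bochner_Integration.integral_sum)
    then show ?thesis by (simp only: sum_distrib_left)
  qed
  finally show ?thesis by (simp add: S_def inner_sum_right)
qed

section \<open>The weighted martingale\<close>

text \<open>The increment of the weighted position from time \<open>n + 1\<close> to
  \<open>n + 2\<close>. The shift makes the martingale start at \<open>X 1\<close>, since the rule
  for a new step needs at least one remembered step.\<close>

definition D :: "nat \<Rightarrow> 'a \<Rightarrow> real^('d::{finite,linorder})" where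
  "D n \<omega> = weight a (n + 2) *\<^sub>R (X (n + 2) \<omega> - (a / real (n + 1)) *\<^sub>R S (n + 1) \<omega>)"

lemma a_pos: "0 < a"
  using a_gt_half by linarith

lemma D_eq: "D n \<omega> = weight a (n + 2) *\<^sub>R S (n + 2) \<omega> - weight a (n + 1) *\<^sub>R S (n + 1) \<omega>"
proof -
  have S: "S (n + 2) \<omega> = S (n + 1) \<omega> + X (n + 2) \<omega>" by (simp add: S_def)
  have w: "weight a (n + 1) = weight a (n + 2) * (1 + a / real (n + 1))"
    using weight_Suc[OF a_pos, of "n + 1"] by simp
  show ?thesis unfolding S w D_def by (simp add: algebra_simps)
qed

lemma sum_D: "(\<Sum>j<n. D j \<omega>) = weight a (n + 1) *\<^sub>R S (n + 1) \<omega> - X 1 \<omega>"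
proof (induction n)
  case 0
  then show ?case using weight_1[OF a_pos] by (simp add: S_def)
next
  case (Suc n)
  then show ?case using D_eq[of n \<omega>] by (simp add: numeral_2_eq_2)
qed

lemma martingale: "bounded_martingale_differences M (\<lambda>n. past (Suc n)) D (\<lambda>n. 2 * weight a (n + 2))"
proof
  show "subalgebra M (past (Suc n))" for n by (rule past_subalgebra)
  show "sets (past (Suc n)) \<subseteq> sets (past (Suc (Suc n)))" for n by (rule past_Suc)
  show "D n \<in> borel_measurable (past (Suc (Suc n)))" for n
    unfolding D_def[abs_def]
    by (intro borel_measurable_scaleR borel_measurable_diff borel_measurable_const X_past S_past) auto
  have norm_X: "AE \<omega> in M. norm (X (n + 2) \<omega>) = 1" for n
    by (rule AE_norm_X) simp
  show "AE \<omega> in M. norm (D n \<omega>) \<le> 2 * weight a (n + 2)" for n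
    using norm_X[of n] AE_norm_S[of "n + 1"]
  proof eventually_elim
    case (elim \<omega>)
    have "norm ((a / real (n + 1)) *\<^sub>R S (n + 1) \<omega>) = a / real (n + 1) * norm (S (n + 1) \<omega>)"
      using a_pos by simp
    \<comment> \<open>The drift has norm at most a \<le> 1 and the step has norm 1; together they
      give the factor 2 in the increment bound.\<close>
    also have "\<dots> \<le> a / real (n + 1) * real (n + 1)"
      using elim(2) a_pos by (intro mult_left_mono) auto
    also have "\<dots> \<le> 1" using a_le_1 by simp
    finally have "norm (X (n + 2) \<omega> - (a / real (n + 1)) *\<^sub>R S (n + 1) \<omega>) \<le> 2"
      using norm_triangle_ineq4[of "X (n + 2) \<omega>" "(a / real (n + 1)) *\<^sub>R S (n + 1) \<omega>"] elim(1)
      by linarith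
    then have "weight a (n + 2) * norm (X (n + 2) \<omega> - (a / real (n + 1)) *\<^sub>R S (n + 1) \<omega>)
        \<le> weight a (n + 2) * 2"
      using weight_pos[OF a_pos, of "n + 2"] by (intro mult_left_mono) auto
    then show ?case using weight_pos[OF a_pos, of "n + 2"] by (simp add: D_def mult.commute)
  qed
  show "(\<integral>\<omega>. h \<omega> \<bullet> D n \<omega> \<partial>M) = 0"
    if h: "h \<in> borel_measurable (past (Suc n))" and hb: "AE \<omega> in M. norm (h \<omega>) \<le> C" for n h C
  proof -
    have hM [measurable]: "h \<in> borel_measurable M"
      using h measurable_from_subalg[OF past_subalgebra] by blast
    have int: "integrable M (\<lambda>\<omega>. h \<omega> \<bullet> Z \<omega>)"
      if [measurable]: "Z \<in> borel_measurable M" and Z: "AE \<omega> in M. norm (Z \<omega>) \<le> K" for Z K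
    proof (rule integrable_const_bound[where B="\<bar>C\<bar> * \<bar>K\<bar>"])
      show "AE \<omega> in M. norm (h \<omega> \<bullet> Z \<omega>) \<le> \<bar>C\<bar> * \<bar>K\<bar>"
        using hb Z
      proof eventually_elim
        case (elim \<omega>)
        have "norm (h \<omega> \<bullet> Z \<omega>) \<le> norm (h \<omega>) * norm (Z \<omega>)"
          by (simp add: Cauchy_Schwarz_ineq2)
        also have "\<dots> \<le> \<bar>C\<bar> * \<bar>K\<bar>" using elim by (intro mult_mono) auto
        finally show ?case .
      qed
    qed measurable
    have "AE \<omega> in M. norm (X (n + 2) \<omega>) \<le> 1"
      using norm_X[of n] by eventually_elim simp
    then have iX: "integrable M (\<lambda>\<omega>. h \<omega> \<bullet> X (n + 2) \<omega>)"
      by (rule int[rotated]) (rule X_meas, simp)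
    have iS: "integrable M (\<lambda>\<omega>. h \<omega> \<bullet> S (n + 1) \<omega>)"
      by (rule int[OF _ AE_norm_S]) measurable
    have "(\<integral>\<omega>. h \<omega> \<bullet> D n \<omega> \<partial>M) = (\<integral>\<omega>. weight a (n + 2) * (h \<omega> \<bullet> X (n + 2) \<omega>
        - a / real (n + 1) * (h \<omega> \<bullet> S (n + 1) \<omega>)) \<partial>M)"
      by (simp add: D_def inner_diff_right)
    also have "\<dots> = weight a (n + 2) * ((\<integral>\<omega>. h \<omega> \<bullet> X (n + 2) \<omega> \<partial>M)
        - a / real (n + 1) * (\<integral>\<omega>. h \<omega> \<bullet> S (n + 1) \<omega> \<partial>M))"
      using iX iS
      by (subst integral_mult_right_zero, subst Bochner_Integration.integral_diff)
        (simp_all only: integrable_mult_right integral_mult_right_zero)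
    also have "\<dots> = 0"
      using integral_inner_X_Suc[OF _ h hb] by simp
    finally show ?thesis .
  qed
  have "summable (\<lambda>n. (weight a (n + 2))\<^sup>2)"
    by (rule summable_ignore_initial_segment[OF summable_weight_squares[OF a_gt_half]])
  then show "summable (\<lambda>n. (2 * weight a (n + 2))\<^sup>2)"
    by (simp only: power_mult_distrib summable_mult)
qed

interpretation mart: bounded_martingale_differences M "\<lambda>n. past (Suc n)" D "\<lambda>n. 2 * weight a (n + 2)"
  by (rule martingale)

section \<open>The limit of the weighted position\<close>

definition Y :: "'a \<Rightarrow> real^('d::{finite,linorder})" where
  "Y \<omega> = X 1 \<omega> + (\<Sum>j. D j \<omega>)"

text \<open>This is Gamma(a+1), the constant between the weighted limit \<open>Y\<close> and the
  limit under division by n^a.\<close>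

definition g :: real where "g = a * Gamma a"

lemma g_pos: "0 < g"
  using a_pos by (simp add: g_def Gamma_real_pos)

lemma Y_measurable [measurable]: "Y \<in> borel_measurable M"
  unfolding Y_def[abs_def] using X_meas[of 1] by measurable

lemma weighted_minus_Y:
  "n \<ge> 1 \<Longrightarrow> weight a n *\<^sub>R S n \<omega> - Y \<omega> = (\<Sum>j<n - 1. D j \<omega>) - (\<Sum>j. D j \<omega>)"
  using sum_D[where n="n - 1" and \<omega>=\<omega>] by (simp add: Y_def)

lemma AE_weighted_tendsto: "AE \<omega> in M. (\<lambda>n. weight a n *\<^sub>R S n \<omega>) \<longlonglongrightarrow> Y \<omega>"
  using mart.AE_summable
proof eventually_elim
  case (elim \<omega>)
  have "(\<lambda>n. X 1 \<omega> + (\<Sum>j<n. D j \<omega>)) \<longlonglongrightarrow> Y \<omega>"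
    unfolding Y_def by (intro tendsto_intros summable_LIMSEQ elim)
  then have "(\<lambda>n. weight a (Suc n) *\<^sub>R S (Suc n) \<omega>) \<longlonglongrightarrow> Y \<omega>"
    by (simp add: sum_D)
  then show ?case by (rule LIMSEQ_imp_Suc)
qed

lemma weighted_square_integrable:
  "n \<ge> 1 \<Longrightarrow> integrable M (\<lambda>\<omega>. (norm (weight a n *\<^sub>R S n \<omega> - Y \<omega>))\<^sup>2)"
  using mart.suminf_square_integral(1)[of "n - 1"] by (simp add: weighted_minus_Y)

lemma weighted_square_tendsto:
  "(\<lambda>n. \<integral>\<omega>. (norm (weight a n *\<^sub>R S n \<omega> - Y \<omega>))\<^sup>2 \<partial>M) \<longlonglongrightarrow> 0"
proof (rule LIMSEQ_imp_Suc, rule tendsto_sandwich[OF _ _ tendsto_const])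
  show "(\<lambda>n. \<Sum>j. (2 * weight a (j + n + 2))\<^sup>2) \<longlonglongrightarrow> 0"
    by (rule mart.tail_squares_tendsto_0)
  show "\<forall>\<^sub>F n in sequentially. (\<integral>\<omega>. (norm (weight a (Suc n) *\<^sub>R S (Suc n) \<omega> - Y \<omega>))\<^sup>2 \<partial>M)
      \<le> (\<Sum>j. (2 * weight a (j + n + 2))\<^sup>2)"
    using mart.suminf_square_integral(2) by (intro always_eventually allI) (simp add: weighted_minus_Y)
qed auto

text \<open>At time 1 the weighted position is \<open>X 1\<close>, of norm 1 almost surely, and it
  differs from \<open>Y\<close> by a square integrable vector.\<close>

lemma Y_square_integrable: "integrable M (\<lambda>\<omega>. (norm (Y \<omega>))\<^sup>2)"
proof (rule Bochner_Integration.integrable_bound)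
  show "integrable M (\<lambda>\<omega>. 2 * 1 + 2 * (norm (weight a 1 *\<^sub>R S 1 \<omega> - Y \<omega>))\<^sup>2)"
    by (intro Bochner_Integration.integrable_add integrable_mult_right
        weighted_square_integrable integrable_const) simp
  show "AE \<omega> in M. norm ((norm (Y \<omega>))\<^sup>2) \<le> norm (2 * 1 + 2 * (norm (weight a 1 *\<^sub>R S 1 \<omega> - Y \<omega>))\<^sup>2)"
    using AE_norm_X[of 1, simplified]
  proof eventually_elim
    case (elim \<omega>)
    then show ?case
      using norm_add_square_le[of "X 1 \<omega>" "Y \<omega> - X 1 \<omega>"] weight_1[OF a_pos]
      by (simp add: S_def norm_minus_commute)
  qed
qed measurable

section \<open>From the weights to powers of n\<close>

lemma normalized_eq:
  "n \<ge> 1 \<Longrightarrow> (1 / real n powr a) *\<^sub>R S n \<omega>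
    = (1 / (weight a n * real n powr a)) *\<^sub>R (weight a n *\<^sub>R S n \<omega>)"
  using weight_pos[OF a_pos, of n] by simp

lemma inverse_weight_tendsto: "(\<lambda>n. 1 / (weight a n * real n powr a)) \<longlonglongrightarrow> 1 / g"
  using weight_asymptotics[of a] g_pos by (intro tendsto_intros) (auto simp: g_def)

lemma AE_normalized_tendsto:
  "AE \<omega> in M. (\<lambda>n. (1 / real n powr a) *\<^sub>R S n \<omega>) \<longlonglongrightarrow> (1 / g) *\<^sub>R Y \<omega>"
  using AE_weighted_tendsto
proof eventually_elim
  case (elim \<omega>)
  have "(\<lambda>n. (1 / (weight a n * real n powr a)) *\<^sub>R (weight a n *\<^sub>R S n \<omega>)) \<longlonglongrightarrow> (1 / g) *\<^sub>R Y \<omega>"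
    by (intro tendsto_scaleR inverse_weight_tendsto elim)
  moreover have "\<forall>\<^sub>F n in sequentially. (1 / (weight a n * real n powr a)) *\<^sub>R (weight a n *\<^sub>R S n \<omega>)
      = (1 / real n powr a) *\<^sub>R S n \<omega>"
    using eventually_ge_at_top[of 1] by eventually_elim (rule normalized_eq[symmetric])
  ultimately show ?case by (rule Lim_transform_eventually)
qed

text \<open>The error splits into the martingale error times the bounded factor \<open>x\<close>,
  and \<open>Y\<close> times the deterministic error \<open>x - 1 / g\<close>. Both parts vanish in
  mean square.\<close>

lemma normalized_square_le:
  assumes n: "n \<ge> 1"
  defines "x \<equiv> 1 / (weight a n * real n powr a)"
  shows "(norm ((1 / real n powr a) *\<^sub>R S n \<omega> - (1 / g) *\<^sub>R Y \<omega>))\<^sup>2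
    \<le> 2 * x\<^sup>2 * (norm (weight a n *\<^sub>R S n \<omega> - Y \<omega>))\<^sup>2 + 2 * (x - 1 / g)\<^sup>2 * (norm (Y \<omega>))\<^sup>2"
proof -
  have "(1 / real n powr a) *\<^sub>R S n \<omega> - (1 / g) *\<^sub>R Y \<omega>
      = x *\<^sub>R (weight a n *\<^sub>R S n \<omega> - Y \<omega>) + (x - 1 / g) *\<^sub>R Y \<omega>"
    unfolding normalized_eq[OF n] x_def[symmetric] by (simp add: scaleR_right_diff_distrib scaleR_left_diff_distrib)
  then show ?thesis
    using norm_add_square_le[of "x *\<^sub>R (weight a n *\<^sub>R S n \<omega> - Y \<omega>)" "(x - 1 / g) *\<^sub>R Y \<omega>"]
    by (simp only: norm_scaleR power_mult_distrib power2_abs mult.assoc)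
qed

lemma normalized_square_integrable:
  assumes n: "n \<ge> 1"
  shows "integrable M (\<lambda>\<omega>. (norm ((1 / real n powr a) *\<^sub>R S n \<omega> - (1 / g) *\<^sub>R Y \<omega>))\<^sup>2)"
proof (rule Bochner_Integration.integrable_bound)
  let ?x = "1 / (weight a n * real n powr a)"
  show "integrable M (\<lambda>\<omega>. 2 * ?x\<^sup>2 * (norm (weight a n *\<^sub>R S n \<omega> - Y \<omega>))\<^sup>2
      + 2 * (?x - 1 / g)\<^sup>2 * (norm (Y \<omega>))\<^sup>2)"
    by (intro Bochner_Integration.integrable_add integrable_mult_right
        weighted_square_integrable n Y_square_integrable)
  show "AE \<omega> in M. norm ((norm ((1 / real n powr a) *\<^sub>R S n \<omega> - (1 / g) *\<^sub>R Y \<omega>))\<^sup>2)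
      \<le> norm (2 * ?x\<^sup>2 * (norm (weight a n *\<^sub>R S n \<omega> - Y \<omega>))\<^sup>2 + 2 * (?x - 1 / g)\<^sup>2 * (norm (Y \<omega>))\<^sup>2)"
  proof (intro always_eventually allI)
    fix \<omega>
    show "norm ((norm ((1 / real n powr a) *\<^sub>R S n \<omega> - (1 / g) *\<^sub>R Y \<omega>))\<^sup>2)
      \<le> norm (2 * ?x\<^sup>2 * (norm (weight a n *\<^sub>R S n \<omega> - Y \<omega>))\<^sup>2 + 2 * (?x - 1 / g)\<^sup>2 * (norm (Y \<omega>))\<^sup>2)"
      using normalized_square_le[OF n, of \<omega>] unfolding real_norm_def by (simp only: abs_of_nonneg zero_le_power2)
  qed
qed measurable

lemma normalized_square_tendsto:
  "(\<lambda>n. \<integral>\<omega>. (norm ((1 / real n powr a) *\<^sub>R S n \<omega> - (1 / g) *\<^sub>R Y \<omega>))\<^sup>2 \<partial>M) \<longlonglongrightarrow> 0"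
proof (rule tendsto_sandwich[OF _ _ tendsto_const])
  let ?x = "\<lambda>n. 1 / (weight a n * real n powr a)"
  let ?e = "\<lambda>n. \<integral>\<omega>. (norm (weight a n *\<^sub>R S n \<omega> - Y \<omega>))\<^sup>2 \<partial>M"
  let ?y = "\<integral>\<omega>. (norm (Y \<omega>))\<^sup>2 \<partial>M"
  show "\<forall>\<^sub>F n in sequentially. (\<integral>\<omega>. (norm ((1 / real n powr a) *\<^sub>R S n \<omega> - (1 / g) *\<^sub>R Y \<omega>))\<^sup>2 \<partial>M)
      \<le> 2 * (?x n)\<^sup>2 * ?e n + 2 * (?x n - 1 / g)\<^sup>2 * ?y"
    using eventually_ge_at_top[of 1]
  proof eventually_elim
    case (elim n)
    have "(\<integral>\<omega>. (norm ((1 / real n powr a) *\<^sub>R S n \<omega> - (1 / g) *\<^sub>R Y \<omega>))\<^sup>2 \<partial>M)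
      \<le> (\<integral>\<omega>. 2 * (?x n)\<^sup>2 * (norm (weight a n *\<^sub>R S n \<omega> - Y \<omega>))\<^sup>2
          + 2 * (?x n - 1 / g)\<^sup>2 * (norm (Y \<omega>))\<^sup>2 \<partial>M)"
      by (intro integral_mono normalized_square_integrable elim normalized_square_le
          Bochner_Integration.integrable_add integrable_mult_right
          weighted_square_integrable Y_square_integrable)
    also have "\<dots> = 2 * (?x n)\<^sup>2 * ?e n + 2 * (?x n - 1 / g)\<^sup>2 * ?y"
      by (subst Bochner_Integration.integral_add)
        (intro integrable_mult_right weighted_square_integrable elim Y_square_integrable
          | simp only: integral_mult_right_zero)+
    finally show ?case .
  qed
  have "(\<lambda>n. 2 * (?x n)\<^sup>2 * ?e n + 2 * (?x n - 1 / g)\<^sup>2 * ?y)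
      \<longlonglongrightarrow> 2 * (1 / g)\<^sup>2 * 0 + 2 * (1 / g - 1 / g)\<^sup>2 * ?y"
    by (intro tendsto_add tendsto_mult tendsto_power tendsto_diff tendsto_const
        inverse_weight_tendsto weighted_square_tendsto)
  then show "(\<lambda>n. 2 * (?x n)\<^sup>2 * ?e n + 2 * (?x n - 1 / g)\<^sup>2 * ?y) \<longlonglongrightarrow> 0" by simp
qed simp

text \<open>Every increment is orthogonal to \<open>v\<close> on the event \<open>X 1 = v\<close>, so a constant \<open>Y\<close> would
  have inner product 1 with each signed basis vector, including both \<open>v\<close> and \<open>- v\<close>.\<close>

lemma Y_not_constant: "\<not> (AE \<omega> in M. Y \<omega> = c)"
proof
  assume const: "AE \<omega> in M. Y \<omega> = c"
  have key: "v \<bullet> c = 1" if v: "v \<in> signed_basis" for v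
  proof -
    let ?E = "{\<omega>\<in>space M. X 1 \<omega> = v}"
    \<comment> \<open>Known at time 1, the initial time of the martingale, so the whole series is
      orthogonal to it.\<close>
    define h where "h \<omega> = (indicator {v} (X 1 \<omega>) :: real) *\<^sub>R v" for \<omega>
    have "(\<lambda>\<omega>. indicator {v} (X 1 \<omega>) :: real) \<in> borel_measurable (past (Suc 0))"
      by (rule measurable_compose[OF X_past[of 1]]) auto
    then have h: "h \<in> borel_measurable (past (Suc 0))"
      unfolding h_def[abs_def] by (intro borel_measurable_scaleR) auto
    have hb: "AE \<omega> in M. norm (h \<omega>) \<le> 1"
      using norm_signed_basis[OF v] by (auto simp: h_def indicator_def)
    have "AE \<omega> in M. h \<omega> \<bullet> (\<Sum>j. D j \<omega>) = (v \<bullet> c - 1) * indicator ?E \<omega>"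
      using const AE_space
    proof eventually_elim
      case (elim \<omega>)
      have "v \<bullet> v = 1" using norm_signed_basis[OF v] by (simp add: norm_eq_1)
      moreover have "(\<Sum>j. D j \<omega>) = c - X 1 \<omega>" using elim by (simp add: Y_def algebra_simps)
      ultimately show ?case using elim by (auto simp: h_def indicator_def inner_diff_right)
    qed
    then have "(\<integral>\<omega>. h \<omega> \<bullet> (\<Sum>j. D j \<omega>) \<partial>M) = (\<integral>\<omega>. (v \<bullet> c - 1) * indicator ?E \<omega> \<partial>M)"
      using mart.measurable_F[OF h] event_X[of 1 v] by (intro integral_cong_AE) auto
    then have "0 = (v \<bullet> c - 1) * prob ?E"
      using mart.integral_inner_suminf[OF h hb] event_X[of 1 v] by simp
    \<comment> \<open>The event has probability 1/(2d), which is positive, so the other factor must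
      be 0.\<close>
    then show ?thesis using X1_law[OF v] by simp
  qed
  fix i :: 'd
  have "axis i 1 \<bullet> c = 1" "axis i (-1) \<bullet> c = 1"
    using key by (auto simp: signed_basis_def)
  then show False by (simp add: inner_axis')
qed

end

theorem theorem3p7:
  fixes M :: "'a measure"
    and p :: real
    and X :: "nat \<Rightarrow> 'a \<Rightarrow> real^('d::{finite,linorder})"
    and b :: "nat \<Rightarrow> 'a \<Rightarrow> nat"
    and A :: "nat \<Rightarrow> 'a \<Rightarrow> real^('d::{finite,linorder})^('d::{finite,linorder})"
    and S :: "nat \<Rightarrow> 'a \<Rightarrow> real^('d::{finite,linorder})"
  assumes P: "prob_space M"
    and p_gt: "(2 * real CARD('d) + 1) / (4 * real CARD('d)) < p"
    and p_le: "p \<le> 1"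
    and X_meas: "\<And>k. k \<ge> 1 \<Longrightarrow> X k \<in> borel_measurable M"
    and b_meas: "\<And>n. n \<ge> 1 \<Longrightarrow> b n \<in> measurable M (count_space UNIV)"
    and A_meas: "\<And>n. n \<ge> 1 \<Longrightarrow> A n \<in> borel_measurable M"
    and X1_law: "\<And>v. v \<in> signed_basis \<Longrightarrow>
        measure M {\<omega> \<in> space M. X 1 \<omega> = v} = 1 / (2 * real CARD('d))"
    and b_law: "\<And>n k. n \<ge> 1 \<Longrightarrow> k \<in> {1..n} \<Longrightarrow>
        measure M {\<omega> \<in> space M. b n \<omega> = k} = 1 / real n"
    and A_law_id: "\<And>n. n \<ge> 1 \<Longrightarrow> measure M {\<omega> \<in> space M. A n \<omega> = mat 1} = p"
    and A_law_other: "\<And>n B. n \<ge> 1 \<Longrightarrow> B \<in> other_mats \<Longrightarrow>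
        measure M {\<omega> \<in> space M. A n \<omega> = B} = (1 - p) / (2 * real CARD('d) - 1)"
    and indep: "\<And>n. n \<ge> 1 \<Longrightarrow>
        prob_space.indep_sets M
          (\<lambda>i::nat. if i = 0 then sets (vimage_algebra (space M) (b n) (count_space UNIV))
                 else if i = 1 then sets (vimage_algebra (space M) (A n) borel)
                 else sets (vimage_algebra (space M) (\<lambda>\<omega>. restrict (\<lambda>k. X k \<omega>) {1..n})
                                         (\<Pi>\<^sub>M k\<in>{1..n}. borel)))
          {0, 1, 2}"
    and step: "\<And>n \<omega>. n \<ge> 1 \<Longrightarrow> \<omega> \<in> space M \<Longrightarrow>
        X (Suc n) \<omega> = A n \<omega> *v X (b n \<omega>) \<omega>"
    and S_def: "\<And>n \<omega>. S n \<omega> = (\<Sum>k\<in>{1..n}. X k \<omega>)"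
  shows "\<exists>L :: 'a \<Rightarrow> real^('d::{finite,linorder}).
      L \<in> borel_measurable M \<and>
      \<not> (\<exists>c. AE \<omega> in M. L \<omega> = c) \<and>
      (AE \<omega> in M. (\<lambda>n. (1 / real n powr ((2 * real CARD('d) * p - 1) / (2 * real CARD('d) - 1)))
                              *\<^sub>R S n \<omega>) \<longlonglongrightarrow> L \<omega>) \<and>
      (\<forall>n\<ge>1. integrable M (\<lambda>\<omega>. (norm ((1 / real n powr ((2 * real CARD('d) * p - 1) / (2 * real CARD('d) - 1)))
                              *\<^sub>R S n \<omega> - L \<omega>))\<^sup>2)) \<and>
      (\<lambda>n. integral\<^sup>L M (\<lambda>\<omega>. (norm ((1 / real n powr ((2 * real CARD('d) * p - 1) / (2 * real CARD('d) - 1)))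
                              *\<^sub>R S n \<omega> - L \<omega>))\<^sup>2)) \<longlonglongrightarrow> 0"
proof -
  interpret walk: elephant_walk M p X b A
    by (rule elephant_walk.intro[OF P elephant_walk_axioms.intro]) fact+
  have S: "S n \<omega> = walk.S n \<omega>" for n \<omega>
    by (simp add: S_def walk.S_def)
  define L where "L \<omega> = (1 / walk.g) *\<^sub>R walk.Y \<omega>" for \<omega>
  have "\<not> (AE \<omega> in M. L \<omega> = c)" for c
  proof
    assume "AE \<omega> in M. L \<omega> = c"
    then have "AE \<omega> in M. walk.Y \<omega> = walk.g *\<^sub>R c"
      by eventually_elim (use walk.g_pos in \<open>auto simp: L_def\<close>)
    then show False using walk.Y_not_constant by blast
  qed
  then show ?thesis
    unfolding walk.a_def[symmetric] S
    using walk.AE_normalized_tendsto walk.normalized_square_integrable walk.normalized_square_tendsto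
    by (intro exI[of _ L]) (simp add: L_def[abs_def])
qed

end
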